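(* Let $X=(X(t))_{t\ge 0}$ be a real-valued Lévy process with triplet $(\sigma^2,b,\nu)$, where $\nu(\mathbb{R}_+)>0$ and $\nu(\mathbb{R}_-)>0$. Let $f\colon\mathbb{R}_+\to\mathbb{R}_+$ be a differentiable, non-decreasing function such that $\int_1^\infty f'(s)^2\,ds<\infty$ and $\sup_{s\ge 1}|f'(s)|<\infty$. Let $\delta>0$. If $$\mathbb{P}\left(X(t)\le 1,\ 0\le t\le T\right)=T^{-\delta+o(1)},\qquad T\to\infty,$$ then $$\mathbb{P}\left(X(t)\le 1+f(t),\ 0\le t\le T\right)=T^{-\delta+o(1)},\qquad T\to\infty.$$
   Context: A Lévy process here is a real-valued process starting at $0$ with stationary and independent increments and almost surely càdlàg paths. It has triplet $(\sigma^2,b,\nu)$, with $\sigma^2\ge 0$, $b\in\mathbb{R}$ and $\nu$ a positive measure concentrated on $\mathbb{R}\setminus\{0\}$ (the Lévy measure) satisfying $\int_{\mathbb{R}}(1\wedge x^2)\,\nu(dx)<\infty$, if $\mathbb{E}(e^{iuX(t)})=e^{t\Psi(u)}$ for all $u\in\mathbb{R}$, $t\ge 0$, where $$\Psi(u)=ibu-\frac{\sigma^2}{2}u^2+\int_{\mathbb{R}}\left(e^{iux}-1-\mathbf{1}_{\{|x|\le 1\}}iux\right)\nu(dx).$$ $\mathbb{R}_+=[0,\infty)$ as the domain and range of $f$; $\nu(\mathbb{R}_+)$ and $\nu(\mathbb{R}_-)$ are the $\nu$-masses of the positive and negative half-lines. $\mathbb{P}(X(t)\le g(t),\ 0\le t\le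 T)$ denotes the probability that $X(t)\le g(t)$ holds for all $t\in[0,T]$. For a function $p$, "$p(T)=T^{-\delta+o(1)}$ as $T\to\infty$" means $p(T)>0$ for large $T$ and $\ln p(T)/\ln T\to-\delta$ as $T\to\infty$. *)

theory Defs
  imports "HOL-Probability.Probability"
begin

definition cadlag :: "(real \<Rightarrow> real) \<Rightarrow> bool" where
  "cadlag x \<longleftrightarrow>
     (\<forall>t\<ge>0. (x \<longlongrightarrow> x t) (at_right t)) \<and>
     (\<forall>t>0. \<exists>l. (x \<longlongrightarrow> l) (at_left t))"

text \<open>The time index is \<open>real\<close>, but only times \<open>t \<ge> 0\<close> are constrained or used.\<close>

locale levy_process = prob_space M for M :: "'a measure" +
  fixes X :: "real \<Rightarrow> 'a \<Rightarrow> real"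
  assumes random_variable_X: "\<And>t. 0 \<le> t \<Longrightarrow> random_variable borel (X t)"
    and start_zero: "AE \<omega> in M. X 0 \<omega> = 0"
    and stationary_increments:
      "\<And>s h. 0 \<le> s \<Longrightarrow> 0 \<le> h \<Longrightarrow>
         distr M borel (\<lambda>\<omega>. X (s + h) \<omega> - X s \<omega>) = distr M borel (\<lambda>\<omega>. X h \<omega> - X 0 \<omega>)"
    and independent_increments:
      "\<And>(n::nat) (t :: nat \<Rightarrow> real). 0 \<le> t 0 \<Longrightarrow> (\<And>i. i < n \<Longrightarrow> t i < t (Suc i)) \<Longrightarrow>
         indep_vars (\<lambda>_. borel) (\<lambda>i \<omega>. X (t (Suc i)) \<omega> - X (t i) \<omega>) {..<n}"
    and cadlag_paths: "AE \<omega> in M. cadlag (\<lambda>t. X t \<omega>)"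

definition levy_measure :: "real measure \<Rightarrow> bool" where
  "levy_measure \<nu> \<longleftrightarrow>
     sets \<nu> = sets borel \<and> emeasure \<nu> {0} = 0 \<and>
     (\<integral>\<^sup>+ x. ennreal (min 1 (x\<^sup>2)) \<partial>\<nu>) < \<infinity>"

text \<open>The first argument of \<open>levy_exponent\<close> and of \<open>has_levy_triplet\<close> below is the variance
  \<open>\<sigma>\<^sup>2\<close>, not \<open>\<sigma>\<close>.\<close>

definition levy_exponent :: "real \<Rightarrow> real \<Rightarrow> real measure \<Rightarrow> real \<Rightarrow> complex" where
  "levy_exponent \<sigma>2 b \<nu> u =
     \<i> * of_real (b * u) - of_real (\<sigma>2 / 2 * u\<^sup>2) +
     (CLINT x|\<nu>. iexp (u * x) - 1 - indicator {x. \<bar>x\<bar> \<le> 1} x * (\<i> * of_real (u * x)))"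

definition has_levy_triplet ::
    "'a measure \<Rightarrow> (real \<Rightarrow> 'a \<Rightarrow> real) \<Rightarrow> real \<Rightarrow> real \<Rightarrow> real measure \<Rightarrow> bool" where
  "has_levy_triplet M X \<sigma>2 b \<nu> \<longleftrightarrow>
     0 \<le> \<sigma>2 \<and> levy_measure \<nu> \<and>
     (\<forall>u. \<forall>t\<ge>0. (CLINT \<omega>|M. iexp (u * X t \<omega>)) = exp (of_real t * levy_exponent \<sigma>2 b \<nu> u))"

text \<open>As paths are only almost surely cadlag, the event below (an uncountable intersection)
  need not be in \<open>sets M\<close>. For continuous \<open>g\<close> it differs from an event determined by countably
  many times only inside a null set, so it is measurable for the completion of \<open>M\<close>.\<close>

definition prob_below :: "'a measure \<Rightarrow> (real \<Rightarrow> 'a \<Rightarrow> real) \<Rightarrow> (real \<Rightarrow> real) \<Rightarrow> real \<Rightarrow> real" where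
  "prob_below M X g T =
     measure (completion M) {\<omega> \<in> space M. \<forall>t\<in>{0..T}. X t \<omega> \<le> g t}"

text \<open>\<open>p T = T powr (- \<delta> + o(1))\<close> as \<open>T \<rightarrow> \<infinity>\<close>:\<close>

definition has_decay_exponent :: "(real \<Rightarrow> real) \<Rightarrow> real \<Rightarrow> bool" where
  "has_decay_exponent p \<delta> \<longleftrightarrow>
     (\<forall>\<^sub>F T in at_top. 0 < p T) \<and> ((\<lambda>T. ln (p T) / ln T) \<longlongrightarrow> - \<delta>) at_top"

end

theory Submission
  imports Defs
begin

text \<open>
  The lower bound is monotonicity. For the upper bound, restrict the process to a grid of mesh \<open>h\<close> and
  change the law \<open>\<mu>\<close> of its independent increments \<open>\<xi>\<^sub>i\<close>: with a small probability \<open>\<kappa>\<^sub>i\<close> the increment is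
  replaced by one conditioned on \<open>J = (-\<infinity>, -2d]\<close>, that is, \<open>\<mu>\<close> gets the density
  \<open>1 - \<kappa>\<^sub>i + \<kappa>\<^sub>i 1\<^sub>J / \<mu>(J)\<close>. Since \<open>\<nu>(-\<infinity>, 0) > 0\<close>, one has \<open>\<mu>(J) \<ge> c h\<close> for a suitable \<open>d\<close>, so the
  \<open>p\<close>-th moment of the density of the whole path is at most \<open>exp (D \<Sum>\<^sub>i \<kappa>\<^sub>i\<^sup>2 / (c h))\<close>; with \<open>\<kappa>\<^sub>i\<close> proportional
  to the increments of \<open>f\<close> this is bounded, uniformly in the time horizon, by means of \<open>\<integral> f'\<^sup>2\<close>.
  By a coupling, the modified walk lies, up to an error which vanishes as \<open>h \<rightarrow> 0\<close>, below the original
  one minus \<open>d\<close> times the number of replacements, and with a probability bounded from below the latter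
  quantity dominates \<open>f\<close> for all times. Hoelder's inequality thus gives
  \<open>P(X \<le> 1 + f on [0,T]) \<le> K P(X \<le> 1 on [0,T])\<^sup>1\<^sup>-\<^sup>1\<^sup>/\<^sup>p\<close> for every \<open>p \<ge> 2\<close>, with \<open>K\<close> independent of \<open>T\<close>.
\<close>

section \<open>Large negative increments over short times\<close>

text \<open>It makes the weight integrable for every Levy measure: the half-angle formula gives a
  quadratic bound for small \<open>x\<close>, and the trivial bound serves for the rest.\<close>

lemma sqr_one_minus_cos_le:
  fixes a x :: real
  assumes "0 < a" "a \<le> 1"
  shows "(1 - cos (a * x))\<^sup>2 \<le> 4 * min 1 (x\<^sup>2)"
proof -
  have le2: "1 - cos (a * x) \<le> 2" using cos_ge_minus_one[of "a * x"] by linarith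
  have nonneg: "0 \<le> 1 - cos (a * x)" by simp
  have "(1 - cos (a * x))\<^sup>2 \<le> 2\<^sup>2" by (rule power_mono[OF le2 nonneg])
  moreover have "(1 - cos (a * x))\<^sup>2 \<le> 4 * x\<^sup>2"
  proof -
    have "1 - cos (a * x) = 2 * (sin (a * x / 2))\<^sup>2"
      using cos_double_sin[of "a * x / 2"] by simp
    also have "\<dots> \<le> 2 * (a * x / 2)\<^sup>2"
      using abs_sin_x_le_abs_x[of "a * x / 2"] by (simp only: abs_le_square_iff)
    also have "\<dots> = a\<^sup>2 * x\<^sup>2 / 2" by (simp add: power2_eq_square)
    also have "\<dots> \<le> 1 * x\<^sup>2"
      using assms power_le_one[of a 2] mult_right_mono[of "a\<^sup>2" 1 "x\<^sup>2"] zero_le_power2[of x]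
      unfolding mult_1_left by linarith
    finally have "1 - cos (a * x) \<le> x\<^sup>2" by simp
    then have "(1 - cos (a * x)) * (1 - cos (a * x)) \<le> x\<^sup>2 * 2"
      using le2 nonneg by (intro mult_mono) auto
    then have "(1 - cos (a * x))\<^sup>2 \<le> 2 * x\<^sup>2" by (simp add: power2_eq_square)
    then show ?thesis using zero_le_power2[of x] by linarith
  qed
  ultimately show ?thesis by (simp add: min_def)
qed

text \<open>A quarter of the fourth central difference of \<open>F\<close> with step
  \<open>a\<close>. With this normalisation it acts on \<open>iexp (u * x)\<close>, as a function of
  \<open>u\<close>, as multiplication by \<open>(1 - cos (a * x))\<^sup>2\<close>.\<close>

definition diff4 :: "real \<Rightarrow> (real \<Rightarrow> complex) \<Rightarrow> real \<Rightarrow> complex" where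
  "diff4 a F u = 3 / 2 * F u - F (u + a) - F (u - a) + (F (u + 2 * a) + F (u - 2 * a)) / 4"

lemma diff4_iexp: "diff4 a (\<lambda>u. iexp (u * x)) u = iexp (u * x) * of_real ((1 - cos (a * x))\<^sup>2)"
proof -
  define E E' :: complex where "E = iexp (a * x)" and "E' = iexp (- a * x)"
  have sum: "E + E' = of_real (2 * cos (a * x))"
    by (simp add: E_def E'_def complex_eq_iff Re_exp Im_exp)
  have "E * E' = 1" by (simp add: E_def E'_def flip: exp_add)
  then have sq: "E\<^sup>2 + E'\<^sup>2 = (E + E')\<^sup>2 - 2" by (simp add: power2_sum)
  have s: "iexp ((u + a) * x) = iexp (u * x) * E" "iexp ((u - a) * x) = iexp (u * x) * E'"
    "iexp ((u + 2 * a) * x) = iexp (u * x) * E\<^sup>2" "iexp ((u - 2 * a) * x) = iexp (u * x) * E'\<^sup>2"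
    by (simp_all add: E_def E'_def power2_eq_square algebra_simps flip: exp_add)
  have "diff4 a (\<lambda>u. iexp (u * x)) u = iexp (u * x) * (3 / 2 - (E + E') + (E\<^sup>2 + E'\<^sup>2) / 4)"
    unfolding diff4_def s by (simp add: algebra_simps add_divide_distrib)
  also have "3 / 2 - (E + E') + (E\<^sup>2 + E'\<^sup>2) / 4 = of_real ((1 - cos (a * x))\<^sup>2)"
    unfolding sq sum by (simp add: power2_eq_square field_simps)
  finally show ?thesis .
qed

text \<open>For \<open>\<bar>x\<bar> \<le> 1\<close> the compensated integrand is a second order
  Taylor remainder, elsewhere it is bounded; \<open>min 1 (x\<^sup>2)\<close> dominates both up to a
  factor.\<close>

lemma integrable_levy_integrand:
  assumes "levy_measure \<nu>"
  shows "integrable \<nu> (\<lambda>x. iexp (u * x) - 1 - indicator {x. \<bar>x\<bar> \<le> 1} x * (\<i> * of_real (u * x)))"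
    and "integrable \<nu> (\<lambda>x. min 1 (x\<^sup>2))"
proof -
  have [measurable_cong]: "sets \<nu> = sets borel" and fin: "(\<integral>\<^sup>+ x. ennreal (min 1 (x\<^sup>2)) \<partial>\<nu>) < \<infinity>"
    using assms by (auto simp: levy_measure_def)
  show int: "integrable \<nu> (\<lambda>x. min 1 (x\<^sup>2))"
    using fin by (intro integrableI_nonneg) auto
  show "integrable \<nu> (\<lambda>x. iexp (u * x) - 1 - indicator {x. \<bar>x\<bar> \<le> 1} x * (\<i> * of_real (u * x)))"
  proof (rule Bochner_Integration.integrable_bound[OF integrable_mult_right[OF int, of "2 + u\<^sup>2"]])
    show "(\<lambda>x. iexp (u * x) - 1 - indicator {x. \<bar>x\<bar> \<le> 1} x * (\<i> * of_real (u * x))) \<in> borel_measurable \<nu>"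
      by measurable
    show "AE x in \<nu>. norm (iexp (u * x) - 1 - indicator {x. \<bar>x\<bar> \<le> 1} x * (\<i> * of_real (u * x)))
        \<le> norm ((2 + u\<^sup>2) * min 1 (x\<^sup>2))"
    proof (rule AE_I2)
      fix x
      show "norm (iexp (u * x) - 1 - indicator {x. \<bar>x\<bar> \<le> 1} x * (\<i> * of_real (u * x)))
        \<le> norm ((2 + u\<^sup>2) * min 1 (x\<^sup>2))"
      proof (cases "\<bar>x\<bar> \<le> 1")
        case True
        have "norm (iexp (u * x) - 1 - \<i> * of_real (u * x)) \<le> (u * x)\<^sup>2 / 2"
          using iexp_approx1[of "u * x" 1] by (simp add: power2_eq_square algebra_simps)
        also have "\<dots> \<le> (2 + u\<^sup>2) * x\<^sup>2"
          by (simp add: power_mult_distrib algebra_simps)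
        finally show ?thesis using True by (simp add: abs_square_le_1 min_absorb2)
      next
        case False
        then have "1 \<le> x\<^sup>2" using abs_square_le_1[of x] by linarith
        moreover have "norm (iexp (u * x) - 1) \<le> 2"
          using norm_triangle_ineq4[of "iexp (u * x)" 1] by simp
        ultimately have "norm (iexp (u * x) - 1) \<le> 2 + u\<^sup>2" using zero_le_power2[of u] by linarith
        then show ?thesis using False \<open>1 \<le> x\<^sup>2\<close> by (simp add: min_absorb1)
      qed
    qed
  qed
qed

text \<open>A fourth difference annihilates polynomials in \<open>u\<close> of degree at most 3.
  Drift, Gaussian term and compensator are of this kind, so only the oscillating part of the
  integrand survives.\<close>

lemma diff4_levy_exponent:
  assumes "levy_measure \<nu>"
  shows "diff4 a (levy_exponent \<sigma>2 b \<nu>) u = (CLINT x|\<nu>. iexp (u * x) * of_real ((1 - cos (a * x))\<^sup>2))"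
proof -
  define g where "g u x = iexp (u * x) - 1 - indicator {x. \<bar>x\<bar> \<le> 1} x * (\<i> * of_real (u * x))" for u x :: real
  have int: "integrable \<nu> (g u)" for u
    unfolding g_def[abs_def] by (rule integrable_levy_integrand(1)[OF assms])
  have "diff4 a (levy_exponent \<sigma>2 b \<nu>) u = diff4 a (\<lambda>u. CLINT x|\<nu>. g u x) u"
  proof -
    have "levy_exponent \<sigma>2 b \<nu> u =
        \<i> * of_real (b * u) - of_real (\<sigma>2 / 2 * u\<^sup>2) + (CLINT x|\<nu>. g u x)" for u
      by (simp only: levy_exponent_def g_def)
    then show ?thesis unfolding diff4_def by (simp only:) (simp add: field_simps power2_eq_square)
  qed
  also have "\<dots> = (CLINT x|\<nu>. diff4 a (\<lambda>u. g u x) u)"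
    unfolding diff4_def using int by simp
  also have "(\<lambda>x. diff4 a (\<lambda>u. g u x) u) = (\<lambda>x. diff4 a (\<lambda>u. iexp (u * x)) u)"
    unfolding diff4_def g_def by (simp add: field_simps)
  finally show ?thesis unfolding diff4_iexp .
qed

lemma tendsto_exp_difference_quotient:
  fixes z :: complex and h :: "nat \<Rightarrow> real"
  assumes "\<And>n. 0 < h n" "h \<longlonglongrightarrow> 0"
  shows "(\<lambda>n. (exp (of_real (h n) * z) - 1) / of_real (h n)) \<longlonglongrightarrow> z"
proof -
  have "((\<lambda>w. exp (w * z)) has_field_derivative z) (at 0)"
    by (auto intro!: derivative_eq_intros)
  then have "((\<lambda>w. (exp (w * z) - 1) / w) \<longlongrightarrow> z) (at 0)"
    by (simp add: has_field_derivative_iff)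
  moreover have "filterlim (\<lambda>n. complex_of_real (h n)) (at 0) sequentially"
    using tendsto_of_real[OF assms(2)] assms(1) by (auto simp: filterlim_at less_le)
  ultimately show ?thesis by (rule filterlim_compose)
qed

text \<open>The measures \<open>(1 - cos (a x))\<^sup>2 \<mu>\<^sub>h(dx) / h\<close> converge weakly to \<open>(1 - cos (a x))\<^sup>2 \<nu>(dx)\<close> as
  \<open>h \<rightarrow> 0\<close>. On the Fourier side the weight is a fourth difference, which annihilates the drift and
  Gaussian parts of the exponent, and the limit follows from Levy's continuity theorem.\<close>

lemma levy_small_time_lower_bound:
  fixes \<mu> :: "nat \<Rightarrow> real measure" and h :: "nat \<Rightarrow> real"
  assumes \<mu>: "\<And>n. real_distribution (\<mu> n)" and h: "\<And>n. 0 < h n" "h \<longlonglongrightarrow> 0"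
    and char: "\<And>n u. char (\<mu> n) u = exp (of_real (h n) * levy_exponent \<sigma>2 b \<nu> u)"
    and \<nu>: "levy_measure \<nu>" "emeasure \<nu> {..<0} > 0"
  shows "\<exists>d>0. \<exists>c>0. \<forall>\<^sub>F n in sequentially. c * h n \<le> measure (\<mu> n) {..- 2 * d}"
proof -
  interpret \<mu>: real_distribution "\<mu> n" for n by (rule \<mu>)
  have sets[simp, measurable_cong]: "sets \<nu> = sets borel" using \<nu>(1) by (simp add: levy_measure_def)
  have space[simp]: "space \<nu> = UNIV" using sets_eq_imp_space_eq[OF sets] by simp
  obtain k :: nat where k: "emeasure \<nu> {- real (Suc k)..<0} > 0"
  proof -
    have "{..<0::real} = (\<Union>k. {- real (Suc k)..<0})"
    proof (intro equalityI subsetI)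
      fix x :: real assume "x \<in> {..<0}"
      then show "x \<in> (\<Union>k. {- real (Suc k)..<0})"
        using real_arch_simple[of "- x"] by (auto simp: algebra_simps) (smt (verit))
    qed auto
    then have "\<not> (\<forall>k. {- real (Suc k)..<0} \<in> null_sets \<nu>)"
      using \<nu>(2) null_sets_UN'[of "UNIV :: nat set" "\<lambda>k. {- real (Suc k)..<0}" \<nu>]
      by (auto simp: null_sets_def)
    then show ?thesis using that by (auto simp: null_sets_def zero_less_iff_neq_zero)
  qed
  \<comment> \<open>This scale puts \<open>a * x\<close> into \<open>[-1, 0)\<close> for
    \<open>x\<close> in the window found above. There \<open>cos (a * x) < 1\<close>, so the weight
    is positive on a set of positive \<open>\<nu>\<close>-measure.\<close>
  define a where "a = 1 / real (Suc k)"
  have a: "0 < a" "a \<le> 1" by (auto simp: a_def)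
  define w where "w x = (1 - cos (a * x))\<^sup>2" for x
  have w_meas[measurable]: "w \<in> borel_measurable borel" unfolding w_def[abs_def] by measurable
  have w0: "0 \<le> w x" and w4: "w x \<le> 4" for x
    using sqr_one_minus_cos_le[OF a, of x] by (auto simp: w_def)
  have w_pos: "0 < w x" if "x \<in> {- real (Suc k)..<0}" for x
  proof -
    have "- 1 \<le> a * x" "a * x < 0" using that by (auto simp: a_def field_simps)
    then have "cos (- (a * x)) < cos 0" using pi_gt3 by (intro cos_monotone_0_pi) auto
    then show ?thesis by (simp add: w_def)
  qed
  have wint: "integrable \<nu> w"
    by (rule Bochner_Integration.integrable_bound[OF integrable_mult_right[OF integrable_levy_integrand(2)[OF \<nu>(1)], of 4]])
       (use sqr_one_minus_cos_le[OF a] in \<open>auto simp: w_def\<close>)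
  have wint': "integrable (\<mu> n) w" for n
    by (rule \<mu>.integrable_const_bound[where B = 4]) (use w0 w4 in auto)
  define c where "c = (\<integral>x. w x \<partial>\<nu>)"
  define cn where "cn n = (\<integral>x. w x \<partial>\<mu> n)" for n
  have c: "c > 0"
  proof -
    have "0 \<le> c" unfolding c_def by (rule integral_nonneg_AE) (use w0 in auto)
    moreover have "c \<noteq> 0"
    proof
      assume "c = 0"
      then have "AE x in \<nu>. w x = 0"
        using integral_nonneg_eq_0_iff_AE[OF wint] w0 by (auto simp: c_def)
      then have "AE x in \<nu>. x \<notin> {- real (Suc k)..<0}"
      by (rule AE_mp) (rule AE_I2, use w_pos in force)
    then show False using k by (subst (asm) AE_iff_measurable[of "{- real (Suc k)..<0}"]) auto
    qed
    ultimately show ?thesis by simp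
  qed
  define \<rho> where "\<rho> = density \<nu> (\<lambda>x. ennreal (w x / c))"
  \<comment> \<open>The value \<open>\<rho>\<close> is a mere filler that keeps
    \<open>\<rho>n n\<close> a probability law in every case; eventually \<open>cn n > 0\<close>, so
    it does not affect the limit.\<close>
  define \<rho>n where "\<rho>n n = (if cn n > 0 then density (\<mu> n) (\<lambda>x. ennreal (w x / cn n)) else \<rho>)" for n
  have \<rho>: "real_distribution \<rho>"
  proof (intro real_distribution.intro real_distribution_axioms.intro prob_spaceI)
    have "(\<integral>\<^sup>+ x. ennreal (w x / c) \<partial>\<nu>) = ennreal (\<integral>x. w x / c \<partial>\<nu>)"
      using wint w0 c by (intro nn_integral_eq_integral) auto
    then show "emeasure \<rho> (space \<rho>) = 1"
      using c by (simp add: \<rho>_def emeasure_density flip: c_def)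
  qed (simp add: \<rho>_def)
  have \<rho>n: "real_distribution (\<rho>n n)" for n
  proof (cases "cn n > 0")
    case True
    have "(\<integral>\<^sup>+ x. ennreal (w x / cn n) \<partial>\<mu> n) = ennreal (\<integral>x. w x / cn n \<partial>\<mu> n)"
      using wint' w0 True by (intro nn_integral_eq_integral) auto
    then have "emeasure (\<rho>n n) (space (\<rho>n n)) = 1"
      using True by (simp add: \<rho>n_def emeasure_density flip: cn_def)
    then show ?thesis
      by (intro real_distribution.intro real_distribution_axioms.intro prob_spaceI)
         (simp_all add: \<rho>n_def True)
  qed (simp add: \<rho>n_def \<rho>)
  define \<Psi> where "\<Psi> = levy_exponent \<sigma>2 b \<nu>"
  have D\<Psi>: "(CLINT x|\<nu>. iexp (u * x) * of_real (w x)) = diff4 a \<Psi> u" for u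
    using diff4_levy_exponent[OF \<nu>(1), of a \<sigma>2 b u] by (simp add: \<Psi>_def w_def)
  have D\<phi>: "(CLINT x|\<mu> n. iexp (u * x) * of_real (w x)) = diff4 a (char (\<mu> n)) u" for u n
  proof -
    define e where "e u x = iexp (u * x)" for u x :: real
    have "integrable (\<mu> n) (e u)" for u
      unfolding e_def[abs_def] by (rule \<mu>.integrable_iexp) auto
    then have "diff4 a (\<lambda>u. CLINT x|\<mu> n. e u x) u = (CLINT x|\<mu> n. diff4 a (\<lambda>u. e u x) u)"
      unfolding diff4_def by simp
    then have "diff4 a (char (\<mu> n)) u = (CLINT x|\<mu> n. diff4 a (\<lambda>u. iexp (u * x)) u)"
      by (simp only: e_def char_def[abs_def])
    then show ?thesis by (simp only: diff4_iexp w_def)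
  qed
  \<comment> \<open>The coefficients of the fourth difference add up to 0, so 1 may be subtracted
    from the characteristic function before dividing by \<open>h n\<close>. The quotient then tends
    to the exponent.\<close>
  have lim: "(\<lambda>n. diff4 a (char (\<mu> n)) u / of_real (h n)) \<longlonglongrightarrow> diff4 a \<Psi> u" for u
  proof -
    define q where "q n u = (exp (of_real (h n) * \<Psi> u) - 1) / of_real (h n)" for n u
    have "diff4 a (char (\<mu> n)) u / of_real (h n) = diff4 a (q n) u" for n
      using h(1)[of n] by (simp add: diff4_def q_def char \<Psi>_def diff_divide_distrib add_divide_distrib mult_ac)
    moreover have "(\<lambda>n. q n u) \<longlonglongrightarrow> \<Psi> u" for u
      unfolding q_def by (rule tendsto_exp_difference_quotient[OF h])
    ultimately show ?thesis unfolding diff4_def by (simp only:) (intro tendsto_intros, simp_all)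
  qed
  have c_diff4: "of_real c = diff4 a \<Psi> 0" using D\<Psi>[of 0] by (simp add: c_def)
  have cn_diff4: "of_real (cn n) = diff4 a (char (\<mu> n)) 0" for n using D\<phi>[of n 0] by (simp add: cn_def)
  have "(\<lambda>n. complex_of_real (cn n / h n)) \<longlonglongrightarrow> of_real c"
    using lim[of 0] by (simp add: c_diff4 cn_diff4 of_real_divide)
  then have cn_lim: "(\<lambda>n. cn n / h n) \<longlonglongrightarrow> c" by (simp only: tendsto_of_real_iff)
  have cn_pos: "\<forall>\<^sub>F n in sequentially. cn n > 0"
    using order_tendstoD(1)[OF cn_lim c] by eventually_elim (use h(1) in \<open>simp add: zero_less_divide_iff not_less less_imp_le\<close>, metis h(1) less_asym)
  have char_\<rho>: "char \<rho> u = diff4 a \<Psi> u / of_real c" for u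
  proof -
    have "char \<rho> u = (CLINT x|\<nu>. (w x / c) *\<^sub>R iexp (u * x))"
      unfolding char_def \<rho>_def by (rule integral_density) (use w0 c in auto)
    also have "\<dots> = (CLINT x|\<nu>. iexp (u * x) * of_real (w x) / of_real c)"
      by (simp add: scaleR_conv_of_real mult_ac)
    finally show ?thesis unfolding D\<Psi>[symmetric] by simp
  qed
  have char_\<rho>n: "char (\<rho>n n) u = diff4 a (char (\<mu> n)) u / of_real (cn n)" if "cn n > 0" for n u
  proof -
    have "char (\<rho>n n) u = (CLINT x|\<mu> n. (w x / cn n) *\<^sub>R iexp (u * x))"
      unfolding char_def \<rho>n_def using that by (simp add: integral_density w0)
    also have "\<dots> = (CLINT x|\<mu> n. iexp (u * x) * of_real (w x) / of_real (cn n))"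
      by (simp add: scaleR_conv_of_real mult_ac)
    finally show ?thesis unfolding D\<phi>[symmetric] by simp
  qed
  have "weak_conv_m \<rho>n \<rho>"
  proof (rule levy_continuity[OF \<rho>n \<rho>])
    fix u
    have "(\<lambda>n. (diff4 a (char (\<mu> n)) u / of_real (h n)) / of_real (cn n / h n)) \<longlonglongrightarrow> diff4 a \<Psi> u / of_real c"
      using c by (intro tendsto_divide lim tendsto_of_real cn_lim) auto
    moreover have "\<forall>\<^sub>F n in sequentially. (diff4 a (char (\<mu> n)) u / of_real (h n)) / of_real (cn n / h n) = char (\<rho>n n) u"
      using cn_pos by eventually_elim (use h(1) in \<open>auto simp: char_\<rho>n less_imp_neq[symmetric]\<close>)
    ultimately show "(\<lambda>n. char (\<rho>n n) u) \<longlonglongrightarrow> char \<rho> u"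
      unfolding char_\<rho> by (rule Lim_transform_eventually)
  qed
  then have conv: "(\<lambda>n. cdf (\<rho>n n) x) \<longlonglongrightarrow> cdf \<rho> x" if "isCont (cdf \<rho>) x" for x
    using that by (simp add: weak_conv_m_def weak_conv_def)
  interpret \<rho>: real_distribution \<rho> by (rule \<rho>)
  \<comment> \<open>Otherwise \<open>\<rho>\<close> would vanish on the negative half-line and,
    since \<open>w\<close> is positive on the window, so would \<open>\<nu>\<close> on the
    window.\<close>
  have "\<exists>e<0. measure \<rho> {..e} > 0"
  proof (rule ccontr)
    assume *: "\<not> ?thesis"
    have "{..- (1 / real (Suc n))} \<in> null_sets \<rho>" for n
    proof -
      have "\<not> measure \<rho> {..- (1 / real (Suc n))} > 0" using * by auto
      then show ?thesis by (simp add: null_sets_def \<rho>.emeasure_eq_measure less_le)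
    qed
    then have "(\<Union>n. {..- (1 / real (Suc n))}) \<in> null_sets \<rho>" by (rule null_sets_UN)
    moreover have "{..<0::real} \<subseteq> (\<Union>n. {..- (1 / real (Suc n))})"
    proof
      fix x :: real assume "x \<in> {..<0}"
      then obtain n where "inverse (real (Suc n)) < - x" using reals_Archimedean[of "- x"] by auto
      then show "x \<in> (\<Union>n. {..- (1 / real (Suc n))})" by (auto simp: inverse_eq_divide intro!: exI[of _ n])
    qed
    ultimately have "{..<0} \<in> null_sets \<rho>"
      using null_sets_subset[of "\<Union>n. {..- (1 / real (Suc n))}" \<rho> "{..<0}"] by simp
    then have "AE x in \<rho>. x \<notin> {..<0}" by (rule AE_not_in)
    then have "AE x in \<nu>. 0 < w x \<longrightarrow> x \<notin> {..<0}"
      unfolding \<rho>_def using c by (subst (asm) AE_density) (auto simp: zero_less_divide_iff)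
    then have "AE x in \<nu>. x \<notin> {- real (Suc k)..<0}"
      by eventually_elim (use w_pos in force)
    then show False using k by (subst (asm) AE_iff_measurable[of "{- real (Suc k)..<0}"]) auto
  qed
  then obtain e where e: "e < 0" "measure \<rho> {..e} > 0" by blast
  \<comment> \<open>Only countably many points are atoms, so a continuity point of
    \<open>cdf \<rho>\<close> can be found between \<open>e\<close> and 0, as weak convergence
    demands.\<close>
  obtain x where x: "e < x" "x < 0" "measure \<rho> {x} = 0"
    using open_minus_countable[OF \<rho>.countable_support, of "{e<..<0}"] e by auto
  have "isCont (cdf \<rho>) x" using x(3) \<rho>.isCont_cdf[of x] by simp
  from conv[OF this] have "(\<lambda>n. cdf (\<rho>n n) x) \<longlonglongrightarrow> cdf \<rho> x" .
  moreover have cdf_pos: "cdf \<rho> x > 0"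
    using e x \<rho>.finite_measure_mono[of "{..e}" "{..x}"] by (force simp: cdf_def)
  ultimately have "(\<lambda>n. (cn n / h n) * cdf (\<rho>n n) x) \<longlonglongrightarrow> c * cdf \<rho> x"
    by (intro tendsto_mult cn_lim)
  then have "\<forall>\<^sub>F n in sequentially. (cn n / h n) * cdf (\<rho>n n) x > c * cdf \<rho> x / 2"
    by (rule order_tendstoD) (use c cdf_pos in auto)
  \<comment> \<open>The 8 is a factor 2 lost in passing from the limit to large \<open>n\<close>,
    times the bound 4 for \<open>w\<close>.\<close>
  then have "\<forall>\<^sub>F n in sequentially. c * cdf \<rho> x / 8 * h n \<le> measure (\<mu> n) {..x}"
    using cn_pos
  proof eventually_elim
    case (elim n)
    have "measure (\<rho>n n) {..x} = (\<integral>y. indicat_real {..x} y \<partial>\<rho>n n)"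
      using \<rho>n[of n] by (simp add: real_distribution.space_eq_univ)
    also have "\<dots> = (\<integral>y. (w y / cn n) * indicat_real {..x} y \<partial>\<mu> n)"
    proof -
      have eq: "\<rho>n n = density (\<mu> n) (\<lambda>x. ennreal (w x / cn n))" using elim by (simp add: \<rho>n_def)
      show ?thesis unfolding eq by (subst integral_density) (use elim w0 in auto)
    qed
    also have "\<dots> \<le> (\<integral>y. 4 / cn n * indicat_real {..x} y \<partial>\<mu> n)"
    proof (rule integral_mono)
      show "integrable (\<mu> n) (\<lambda>y. (w y / cn n) * indicat_real {..x} y)"
        by (rule \<mu>.integrable_const_bound[where B = "4 / cn n"])
           (use w0 w4 elim in \<open>auto simp: indicator_def divide_simps\<close>)
      show "(w y / cn n) * indicat_real {..x} y \<le> 4 / cn n * indicat_real {..x} y" for y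
        using w4[of y] elim by (auto simp: indicator_def divide_simps)
      show "integrable (\<mu> n) (\<lambda>y. 4 / cn n * indicat_real {..x} y)"
        by (rule \<mu>.integrable_const_bound[where B = "4 / cn n"])
           (use elim in \<open>auto simp: indicator_def\<close>)
    qed
    also have "\<dots> = 4 / cn n * measure (\<mu> n) {..x}" by simp
    finally have "cn n * cdf (\<rho>n n) x \<le> 4 * measure (\<mu> n) {..x}"
      using elim by (simp add: cdf_def field_simps)
    moreover have "c * cdf \<rho> x / 2 * h n \<le> cn n * cdf (\<rho>n n) x"
      using elim(1) h(1)[of n] by (simp add: field_simps)
    ultimately show ?case by simp
  qed
  moreover have "c * cdf \<rho> x / 8 > 0" using c cdf_pos by simp
  moreover have "{..x} = {..- 2 * (- x / 2)}" "- x / 2 > 0" using x by auto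
  ultimately show ?thesis by metis
qed

section \<open>Random walks below a boundary and tilted steps\<close>

text \<open>A density, with respect to the step law \<open>\<mu>\<close>, of a modified step.
  Boundedness makes all its powers integrable for a probability law.\<close>

definition weight :: "real measure \<Rightarrow> (real \<Rightarrow> real) \<Rightarrow> bool" where
  "weight \<mu> z \<longleftrightarrow> z \<in> borel_measurable borel \<and> (\<forall>y. 0 \<le> z y) \<and> (\<exists>B. \<forall>y. z y \<le> B) \<and> (\<integral>y. z y \<partial>\<mu>) = 1"

text \<open>For independent \<open>\<xi>\<^sub>i\<close> with law \<open>\<mu>\<close>, this is the expectation of \<open>\<Prod>\<^sub>i z\<^sub>i(\<xi>\<^sub>i)\<close> on the event that the walk
  started in \<open>x\<close> satisfies \<open>x + \<xi>\<^sub>1 + \<dots> + \<xi>\<^sub>i \<le> b\<^sub>i\<close> for all \<open>i\<close>.\<close>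

primrec wstay :: "real measure \<Rightarrow> ((real \<Rightarrow> real) \<times> real) list \<Rightarrow> real \<Rightarrow> real" where
  "wstay \<mu> [] x = 1"
| "wstay \<mu> (zb # l) x =
     (\<integral>y. fst zb y * (indicator {..snd zb} (x + y) * wstay \<mu> l (x + y)) \<partial>\<mu>)"

context real_distribution
begin

lemma borel_measurable_M: "borel_measurable M = (borel_measurable borel :: (real \<Rightarrow> 'b :: topological_space) set)"
  by (rule measurable_cong_sets) auto

lemma weightD:
  assumes "weight M z"
  shows "z \<in> borel_measurable borel" "0 \<le> z y" "integrable M z" "integral\<^sup>L M z = 1"
proof -
  obtain B where B: "\<And>y. z y \<le> B" "\<And>y. 0 \<le> z y" and m: "z \<in> borel_measurable borel"
    using assms by (auto simp: weight_def)
  show "integrable M z"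
    by (rule integrable_const_bound[where B = B]) (use B m in \<open>auto simp: borel_measurable_M\<close>)
qed (use assms in \<open>auto simp: weight_def\<close>)

lemma weight_one: "weight M (\<lambda>_. 1)"
  using prob_space by (auto simp: weight_def)

lemma (in -) antimono_borel_measurable:
  fixes g :: "real \<Rightarrow> real"
  assumes "antimono g"
  shows "g \<in> borel_measurable borel"
proof -
  have "mono (\<lambda>x. - g x)" using assms by (auto simp: mono_def antimono_def)
  from borel_measurable_uminus[OF borel_measurable_mono[OF this]] show ?thesis by simp
qed

lemma integrable_mult_bounded:
  fixes z g :: "real \<Rightarrow> real"
  assumes z: "integrable M z" and g: "g \<in> borel_measurable borel" "\<And>y. 0 \<le> g y" "\<And>y. g y \<le> 1"
  shows "integrable M (\<lambda>y. z y * g y)"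
  using z
  by (rule Bochner_Integration.integrable_bound)
     (use g borel_measurable_integrable[OF z] in \<open>auto simp: abs_mult intro!: mult_left_le\<close>)

text \<open>A higher start makes it harder to stay below the boundary, and weights of mean 1
  preserve the bound by 1. Antitonicity also yields the measurability that the next integral of the
  recursion requires.\<close>

lemma wstay_props:
  assumes "\<forall>zb\<in>set l. weight M (fst zb)"
  shows "antimono (wstay M l) \<and> (\<forall>x. 0 \<le> wstay M l x \<and> wstay M l x \<le> 1)"
  using assms
proof (induction l)
  case Nil
  then show ?case by (simp add: antimono_def)
next
  case (Cons zb l)
  obtain z b where zb: "zb = (z, b)" by force
  have w: "weight M z" using Cons.prems zb by auto
  have IH: "antimono (wstay M l)" "\<And>x. 0 \<le> wstay M l x" "\<And>x. wstay M l x \<le> 1"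
    using Cons by auto
  define h where "h x = indicator {..b} x * wstay M l x" for x
  have h: "antimono h" "\<And>x. 0 \<le> h x" "\<And>x. h x \<le> 1"
    using IH by (auto simp: h_def antimono_def indicator_def)
  have hm: "h \<in> borel_measurable borel" by (rule antimono_borel_measurable[OF h(1)])
  have int: "integrable M (\<lambda>y. z y * h (x + y))" for x
    by (rule integrable_mult_bounded[OF weightD(3)[OF w] measurable_compose[OF _ hm] h(2,3)]) simp
  have eq: "wstay M (zb # l) x = (\<integral>y. z y * h (x + y) \<partial>M)" for x
    by (simp add: zb h_def)
  have le: "wstay M (zb # l) x \<le> 1" for x
  proof -
    have "(\<integral>y. z y * h (x + y) \<partial>M) \<le> integral\<^sup>L M z"
    proof (rule integral_mono[OF int weightD(3)[OF w]])
      show "z y * h (x + y) \<le> z y" for y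
        using mult_left_le[OF h(3)[of "x + y"] weightD(2)[OF w, of y]] by simp
    qed
    then show ?thesis unfolding eq weightD(4)[OF w] .
  qed
  have nonneg: "0 \<le> wstay M (zb # l) x" for x
    unfolding eq
  proof (rule integral_nonneg_AE, rule AE_I2)
    show "0 \<le> z y * h (x + y)" for y
      by (rule mult_nonneg_nonneg[OF weightD(2)[OF w] h(2)])
  qed
  have "wstay M (zb # l) x' \<le> wstay M (zb # l) x" if "x \<le> x'" for x x'
    unfolding eq
  proof (rule integral_mono[OF int int])
    have "h (x' + y) \<le> h (x + y)" for y using h(1) that by (simp add: antimono_def)
    then show "z y * h (x' + y) \<le> z y * h (x + y)" for y
      by (rule mult_left_mono[OF _ weightD(2)[OF w]])
  qed
  then have "antimono (wstay M (zb # l))" by (rule antimonoI)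
  then show ?case using le nonneg by blast
qed

lemma wstay_step:
  assumes w: "\<forall>zb\<in>set l. weight M (fst zb)"
  shows "antimono (\<lambda>x. indicator {..b} x * wstay M l x)"
    and "0 \<le> indicator {..b} x * wstay M l x" "indicator {..b} x * wstay M l x \<le> 1"
    and "(\<lambda>x. indicator {..b} x * wstay M l x) \<in> borel_measurable borel"
    and "integrable M z \<Longrightarrow> integrable M (\<lambda>y. z y * (indicator {..b} (x + y) * wstay M l (x + y)))"
proof -
  have IH: "antimono (wstay M l)" "\<And>x. 0 \<le> wstay M l x" "\<And>x. wstay M l x \<le> 1"
    using wstay_props[of l, OF w] by auto
  have h: "antimono (\<lambda>x. indicator {..b} x * wstay M l x)"
    "\<And>x. 0 \<le> indicator {..b} x * wstay M l x" "\<And>x. indicator {..b} x * wstay M l x \<le> 1"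
    using IH by (auto simp: antimono_def indicator_def)
  note hm = antimono_borel_measurable[OF h(1)]
  show "antimono (\<lambda>x. indicator {..b} x * wstay M l x)" by (rule h)
  show "0 \<le> indicator {..b} x * wstay M l x" "indicator {..b} x * wstay M l x \<le> 1"
    by (rule h)+
  show "(\<lambda>x. indicator {..b} x * wstay M l x) \<in> borel_measurable borel" by (rule hm)
  assume z: "integrable M z"
  show "integrable M (\<lambda>y. z y * (indicator {..b} (x + y) * wstay M l (x + y)))"
  proof (rule integrable_mult_bounded[OF z])
    have "(\<lambda>y. x + y) \<in> borel \<rightarrow>\<^sub>M borel" by measurable
    from measurable_compose[OF this hm]
    show "(\<lambda>y. indicator {..b} (x + y) * wstay M l (x + y)) \<in> borel_measurable borel" .
  qed (rule h)+
qed

text \<open>Markov property at the junction: there the walk is at most \<open>c\<close>, and by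
  antitonicity no such position is worse for the second stage than \<open>c\<close> itself.\<close>

lemma wstay_append_ge:
  assumes "\<forall>zb\<in>set (l1 @ l2). weight M (fst zb)"
    and "l1 \<noteq> [] \<Longrightarrow> snd (last l1) \<le> c" "l1 = [] \<Longrightarrow> x \<le> c"
  shows "wstay M l1 x * wstay M l2 c \<le> wstay M (l1 @ l2) x"
  using assms
proof (induction l1 arbitrary: x)
  case Nil
  have "antimono (wstay M l2)" using wstay_props[of l2] Nil by auto
  then show ?case using Nil by (auto simp: antimono_def)
next
  case (Cons zb l1)
  obtain z b where zb: "zb = (z, b)" by force
  have w: "weight M z" using Cons.prems zb by auto
  have *: "wstay M l1 u * wstay M l2 c \<le> wstay M (l1 @ l2) u" if "u \<le> b" for u
    by (rule Cons.IH) (use Cons.prems zb that in \<open>auto split: if_splits\<close>)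
  have 1: "\<forall>zb\<in>set l1. weight M (fst zb)" "\<forall>zb\<in>set (l1 @ l2). weight M (fst zb)"
    using Cons.prems by auto
  have "wstay M (zb # l1) x * wstay M l2 c =
     (\<integral>y. z y * (indicator {..b} (x + y) * wstay M l1 (x + y)) * wstay M l2 c \<partial>M)"
    by (simp add: zb)
  also have "\<dots> \<le> (\<integral>y. z y * (indicator {..b} (x + y) * wstay M (l1 @ l2) (x + y)) \<partial>M)"
    by (intro integral_mono integrable_mult_left wstay_step(5) 1 weightD(3)[OF w])
       (use weightD(2)[OF w] * in \<open>auto simp: indicator_def mult.assoc intro!: mult_left_mono\<close>)
  finally show ?case by (simp add: zb)
qed

lemma wstay_shift:
  "wstay M (map (\<lambda>(z, b). (z, b + c)) l) (x + c) = wstay M l x"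
proof (induction l arbitrary: x)
  case (Cons zb l)
  obtain z b where zb: "zb = (z, b)" by force
  have "wstay M (map (\<lambda>(z, b). (z, b + c)) l) (x + c + y) = wstay M l (x + y)" for y
    using Cons[of "x + y"] by (simp add: algebra_simps)
  moreover have "indicator {..b + c} (x + c + y) = (indicator {..b} (x + y) :: real)" for y
    by (auto simp: indicator_def)
  ultimately show ?case unfolding zb list.map case_prod_conv wstay.simps fst_conv snd_conv by simp
qed simp

section \<open>Hoelder's inequality along the walk\<close>

text \<open>Hoelder's inequality with exponent \<open>p\<close> for the weight, whose conjugate
  turns \<open>g powr (1 - 1 / p)\<close> back into \<open>g\<close>. It follows by integrating
  Young's inequality for the two normalised factors.\<close>

lemma holder_step:
  fixes z g :: "real \<Rightarrow> real" and p :: nat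
  assumes p: "p \<ge> 2" and z: "z \<in> borel_measurable borel" "\<And>y. 0 \<le> z y" "\<And>y. z y \<le> B"
    and C: "(\<integral>y. z y ^ p \<partial>M) \<le> C" "C > 0"
    and g: "g \<in> borel_measurable borel" "\<And>y. 0 \<le> g y" "\<And>y. g y \<le> 1"
  shows "(\<integral>y. z y * g y powr (1 - 1 / p) \<partial>M) \<le> C powr (1 / p) * (\<integral>y. g y \<partial>M) powr (1 - 1 / p)"
proof -
  define r :: real where "r = 1 - 1 / p"
  have r: "0 < r" "r < 1" using p by (auto simp: r_def field_simps)
  have intg: "integrable M g"
    by (rule integrable_const_bound[where B = 1]) (use g in \<open>auto simp: borel_measurable_M\<close>)
  have intz: "integrable M (\<lambda>y. z y ^ p)"
    by (rule integrable_const_bound[where B = "B ^ p"])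
       (use z in \<open>auto simp: borel_measurable_M intro!: power_mono\<close>)
  have intzz: "integrable M z"
    by (rule integrable_const_bound[where B = B]) (use z in \<open>auto simp: borel_measurable_M\<close>)
  show ?thesis
  proof (cases "(\<integral>y. g y \<partial>M) = 0")
    case True
    then have "AE y in M. g y = 0"
      using integral_nonneg_eq_0_iff_AE[OF intg] g(2) by auto
    then have "(\<integral>y. z y * g y powr r \<partial>M) = (\<integral>y. 0 \<partial>M)"
      by (intro integral_cong_AE) (use r z g in \<open>auto simp: borel_measurable_M\<close>)
    then show ?thesis using True by (simp add: r_def)
  next
    case False
    define G where "G = (\<integral>y. g y \<partial>M)"
    have G: "G > 0" using False integral_nonneg_AE[of g M] g(2) by (auto simp: G_def less_le)
    \<comment> \<open>The scaling by \<open>C\<close> and \<open>G\<close> makes the two terms on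
      the right integrate to at most \<open>1 / p\<close> and to \<open>r\<close>, which add up to
      1.\<close>
    have young: "z y * g y powr r \<le> C powr (1 / p) * G powr r * (z y ^ p / (p * C) + r * g y / G)" for y
    proof -
      have "(z y ^ p / C) powr (1 / p) * (g y / G) powr r \<le> 1 / p * (z y ^ p / C) + r * (g y / G)"
      proof (cases "z y = 0 \<or> g y = 0")
        case True
        then show ?thesis using z(2)[of y] g(2)[of y] C G r p by (auto simp: power_0_left)
      next
        case False
        then have "0 < z y" "0 < g y" using z(2)[of y] g(2)[of y] by auto
        then show ?thesis using p C G r by (intro Youngs_inequality_0) (auto simp: r_def)
      qed
      moreover have "(z y ^ p / C) powr (1 / p) = z y / C powr (1 / p)"
        using p z(2)[of y] C by (cases "z y = 0") (auto simp: powr_divide powr_powr simp flip: powr_realpow)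
      moreover have "(g y / G) powr r = g y powr r / G powr r"
        using g(2)[of y] G by (auto simp: powr_divide)
      ultimately show ?thesis using C G p
        by (simp add: field_simps)
    qed
    have "(\<integral>y. z y * g y powr r \<partial>M) \<le> (\<integral>y. C powr (1 / p) * G powr r * (z y ^ p / (p * C) + r * g y / G) \<partial>M)"
    proof (rule integral_mono[OF _ _ young])
      show "integrable M (\<lambda>y. z y * g y powr r)"
        by (rule integrable_mult_bounded[OF intzz]) (use g r in \<open>auto intro: powr_le1\<close>)
    qed (use intg intz in auto)
    also have "\<dots> = C powr (1 / p) * G powr r * ((\<integral>y. z y ^ p \<partial>M) / (p * C) + r * G / G)"
      using intg intz by (simp add: G_def)
    also have "\<dots> \<le> C powr (1 / p) * G powr r * (C / (p * C) + r * G / G)"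
      using C p by (intro mult_left_mono add_right_mono divide_right_mono) auto
    also have "C / (p * C) + r * G / G = 1"
      using C G p by (simp add: r_def)
    finally show ?thesis by (simp add: r_def G_def)
  qed
qed

text \<open>One application of the one-step inequality per step. The induction closes because the
  inner bound is again a power \<open>1 - 1 / p\<close> of a walk probability, and an indicator is
  unchanged by positive powers.\<close>

lemma wstay_holder:
  fixes p :: nat
  assumes p: "p \<ge> 2" and l: "\<forall>zb\<in>set l. weight M (fst zb)"
    and C: "\<forall>zb\<in>set l. 0 < C (fst zb) \<and> (\<integral>y. fst zb y ^ p \<partial>M) \<le> C (fst zb)"
  shows "wstay M l x \<le> prod_list (map (\<lambda>(z, b). C z powr (1 / p)) l) *
           wstay M (map (\<lambda>(z, b). (\<lambda>_. 1, b)) l) x powr (1 - 1 / p)"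
  using l C
proof (induction l arbitrary: x)
  case Nil
  then show ?case by simp
next
  case (Cons zb l)
  obtain z b where zb: "zb = (z, b)" by force
  have w: "weight M z" and Cz: "0 < C z" "(\<integral>y. z y ^ p \<partial>M) \<le> C z" using Cons.prems zb by auto
  define l' where "l' = map (\<lambda>(z, b). (\<lambda>_::real. 1::real, b)) l"
  define r :: real where "r = 1 - 1 / p"
  define K where "K = prod_list (map (\<lambda>(z, b). C z powr (1 / p)) l)"
  have K: "K \<ge> 0" by (auto simp: K_def case_prod_beta intro!: prod_list_nonneg)
  have r: "0 < r" using p by (auto simp: r_def field_simps)
  have wl: "\<forall>zb\<in>set l. weight M (fst zb)" using Cons.prems by auto
  have wl': "\<forall>zb\<in>set l'. weight M (fst zb)" using weight_one by (auto simp: l'_def)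
  obtain B where B: "\<And>y. z y \<le> B" using w by (auto simp: weight_def)
  note s = wstay_step[OF wl'] 
  have IH: "wstay M l u \<le> K * wstay M l' u powr r" for u
    unfolding K_def l'_def r_def by (rule Cons.IH) (use Cons.prems in auto)
  have ind: "indicator {..b} u * wstay M l' u powr r = (indicator {..b} u * wstay M l' u) powr r" for u
    using r by (auto simp: indicator_def)
  have "wstay M (zb # l) x \<le> (\<integral>y. K * (z y * (indicator {..b} (x + y) * wstay M l' (x + y)) powr r) \<partial>M)"
    unfolding wstay.simps zb fst_conv snd_conv
  proof (rule integral_mono)
    show "integrable M (\<lambda>y. z y * (indicator {..b} (x + y) * wstay M l (x + y)))"
      by (rule wstay_step(5)[OF wl weightD(3)[OF w]])
    show "integrable M (\<lambda>y. K * (z y * (indicator {..b} (x + y) * wstay M l' (x + y)) powr r))"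
    proof (intro integrable_mult_right integrable_mult_bounded weightD(3)[OF w])
      show "(\<lambda>y. (indicator {..b} (x + y) * wstay M l' (x + y)) powr r) \<in> borel_measurable borel"
        using measurable_compose[OF _ s(4)[of b], of "\<lambda>y. x + y" borel]
        by (intro powr_real_measurable) auto
      show "(indicator {..b} (x + y) * wstay M l' (x + y)) powr r \<le> 1" for y
        using s(2,3)[of b "x + y"] r by (intro powr_le1) auto
    qed auto
    fix y
    have "indicator {..b} (x + y) * wstay M l (x + y) \<le> indicator {..b} (x + y) * (K * wstay M l' (x + y) powr r)"
      by (intro mult_left_mono IH) auto
    also have "\<dots> = K * (indicator {..b} (x + y) * wstay M l' (x + y)) powr r"
      unfolding ind[symmetric] by (simp add: mult_ac)
    finally have "z y * (indicator {..b} (x + y) * wstay M l (x + y)) \<le> z y * \<dots>"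
      by (intro mult_left_mono) (use weightD(2)[OF w] in auto)
    then show "z y * (indicator {..b} (x + y) * wstay M l (x + y)) \<le> K * (z y * (indicator {..b} (x + y) * wstay M l' (x + y)) powr r)"
      by (simp add: mult_ac)
  qed
  also have "\<dots> = K * (\<integral>y. z y * (indicator {..b} (x + y) * wstay M l' (x + y)) powr r \<partial>M)"
    by simp
  also have "\<dots> \<le> K * (C z powr (1 / p) * (\<integral>y. indicator {..b} (x + y) * wstay M l' (x + y) \<partial>M) powr r)"
    unfolding r_def using s(2,3,4)[of b]
    by (intro mult_left_mono[OF _ K] holder_step[where B = B] p weightD[OF w] B Cz) auto
  finally show ?case
    by (simp add: zb K_def l'_def r_def mult_ac)
qed

section \<open>Moments of the tilted densities\<close>

definition tilt :: "real \<Rightarrow> real \<Rightarrow> real \<Rightarrow> real" where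
  "tilt d \<kappa> y = 1 - \<kappa> + \<kappa> / prob {..- 2 * d} * indicator {..- 2 * d} y"

lemma weight_tilt:
  assumes "0 \<le> \<kappa>" "\<kappa> \<le> 1" "0 < prob {..- 2 * d}"
  shows "weight M (tilt d \<kappa>)"
proof -
  have "integrable M (indicator {..- 2 * d} :: real \<Rightarrow> real)" 
    by (rule integrable_const_bound[where B = 1]) (auto simp: borel_measurable_M)
  then have "(\<integral>y. tilt d \<kappa> y \<partial>M) = 1"
    using assms using prob_space by (simp add: tilt_def)
  moreover have "tilt d \<kappa> y \<le> 1 - \<kappa> + \<kappa> / prob {..- 2 * d}" for y
    using assms by (auto simp: tilt_def indicator_def)
  moreover have "tilt d \<kappa> \<in> borel_measurable borel"
    unfolding tilt_def[abs_def] by measurable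
  ultimately show ?thesis
    using assms by (auto simp: weight_def intro!: exI[of _ "1 - \<kappa> + \<kappa> / prob {..- 2 * d}"])
      (simp add: tilt_def)
qed

end

text \<open>The linear term is there because it has mean zero for a density, so that a moment
  exceeds 1 only by a second order quantity. Multiplying the bound for \<open>p\<close> by
  \<open>z = 1 + (z - 1)\<close> turns \<open>D\<close> into \<open>p + D * z\<close>.\<close>

lemma power_le_second_order:
  fixes B :: real
  assumes "0 \<le> B"
  shows "\<exists>D\<ge>0. \<forall>z. 0 \<le> z \<longrightarrow> z \<le> B \<longrightarrow> z ^ p \<le> 1 + real p * (z - 1) + D * (z - 1)\<^sup>2"
proof (induction p)
  case 0
  show ?case by (rule exI[of _ 0]) auto
next
  case (Suc p)
  then obtain D where D: "D \<ge> 0" "\<And>z. 0 \<le> z \<Longrightarrow> z \<le> B \<Longrightarrow> z ^ p \<le> 1 + real p * (z - 1) + D * (z - 1)\<^sup>2"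
    by blast
  have "z ^ Suc p \<le> 1 + real (Suc p) * (z - 1) + (p + D * B) * (z - 1)\<^sup>2" if z: "0 \<le> z" "z \<le> B" for z
  proof -
    have "z * z ^ p \<le> z * (1 + real p * (z - 1) + D * (z - 1)\<^sup>2)"
      using D(2)[OF z] z by (intro mult_left_mono)
    also have "\<dots> = 1 + real (Suc p) * (z - 1) + (p + D * z) * (z - 1)\<^sup>2"
      by (simp add: algebra_simps power2_eq_square)
    also have "\<dots> \<le> 1 + real (Suc p) * (z - 1) + (p + D * B) * (z - 1)\<^sup>2"
      using z D(1) by (intro add_left_mono mult_right_mono mult_left_mono) auto
    finally show ?thesis by simp
  qed
  moreover have "p + D * B \<ge> 0" using D(1) assms by auto
  ultimately show ?case by blast
qed

context real_distribution
begin

text \<open>The bound on \<open>\<kappa>\<close> keeps the density below \<open>1 + R\<close>, where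
  the second order estimate applies. The linear term integrates to 0, and the variance of the
  density is \<open>\<kappa>\<^sup>2 / m - \<kappa>\<^sup>2\<close>, with \<open>m\<close> the mass
  of the lower tail.\<close>

lemma tilt_moment:
  fixes p :: nat
  assumes D: "D \<ge> 0" "\<And>z. 0 \<le> z \<Longrightarrow> z \<le> 1 + R \<Longrightarrow> z ^ p \<le> 1 + real p * (z - 1) + D * (z - 1)\<^sup>2"
    and k: "0 \<le> \<kappa>" "\<kappa> \<le> 1" "0 < prob {..- 2 * d}" "\<kappa> \<le> R * prob {..- 2 * d}"
  shows "(\<integral>y. tilt d \<kappa> y ^ p \<partial>M) \<le> 1 + D * \<kappa>\<^sup>2 / prob {..- 2 * d}"
proof -
  define m where "m = prob {..- 2 * d}"
  define I :: "real \<Rightarrow> real" where "I = indicator {..- 2 * d}"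
  have m: "m > 0" "\<kappa> \<le> R * m" using k by (auto simp: m_def)
  note w = weight_tilt[OF k(1-3)]
  have intI: "integrable M I" unfolding I_def
    by (rule integrable_const_bound[where B = 1]) (auto simp: borel_measurable_M)
  have EI: "integral\<^sup>L M I = m" by (simp add: I_def m_def)
  have t: "tilt d \<kappa> y = 1 - \<kappa> + \<kappa> / m * I y" for y by (simp add: tilt_def m_def I_def)
  have up: "tilt d \<kappa> y \<le> 1 + R" for y
  proof -
    have "\<kappa> / m * I y \<le> R" using m k by (auto simp: I_def indicator_def field_simps)
    then show ?thesis using k by (simp add: t)
  qed
  have sq: "(tilt d \<kappa> y - 1)\<^sup>2 = \<kappa>\<^sup>2 + (\<kappa>\<^sup>2 / m\<^sup>2 - 2 * \<kappa>\<^sup>2 / m) * I y" for y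
    using m by (auto simp: t I_def indicator_def field_simps power2_eq_square)
  have "(\<integral>y. tilt d \<kappa> y ^ p \<partial>M) \<le> (\<integral>y. 1 + real p * (tilt d \<kappa> y - 1) + D * (\<kappa>\<^sup>2 + (\<kappa>\<^sup>2 / m\<^sup>2 - 2 * \<kappa>\<^sup>2 / m) * I y) \<partial>M)"
  proof (rule integral_mono)
    show "integrable M (\<lambda>y. tilt d \<kappa> y ^ p)"
      by (rule integrable_const_bound[where B = "(1 + R) ^ p"])
       (use weightD[OF w] up in \<open>auto simp: borel_measurable_M intro!: power_mono\<close>)
    show "tilt d \<kappa> y ^ p \<le> 1 + real p * (tilt d \<kappa> y - 1) + D * (\<kappa>\<^sup>2 + (\<kappa>\<^sup>2 / m\<^sup>2 - 2 * \<kappa>\<^sup>2 / m) * I y)" for y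
      unfolding sq[symmetric] by (rule D(2)[OF weightD(2)[OF w] up])
  qed (use intI weightD(3)[OF w] in auto)
  also have "\<dots> = 1 + D * (\<kappa>\<^sup>2 + (\<kappa>\<^sup>2 / m\<^sup>2 - 2 * \<kappa>\<^sup>2 / m) * m)"
    using intI weightD(3,4)[OF w] prob_space by (simp add: EI)
  also have "\<kappa>\<^sup>2 + (\<kappa>\<^sup>2 / m\<^sup>2 - 2 * \<kappa>\<^sup>2 / m) * m = \<kappa>\<^sup>2 / m - \<kappa>\<^sup>2"
    using m by (simp add: field_simps power2_eq_square)
  also have "1 + D * (\<kappa>\<^sup>2 / m - \<kappa>\<^sup>2) \<le> 1 + D * \<kappa>\<^sup>2 / m"
    using D(1) by (simp add: algebra_simps)
  finally show ?thesis by (simp add: m_def)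
qed

end

text \<open>The probability that a walk from \<open>a\<close> whose \<open>i\<close>-th step is \<open>d\<close> with probability \<open>\<kappa>\<^sub>i\<close> and \<open>0\<close>
  otherwise stays above \<open>b\<^sub>i - 1\<close>, so that subtracting it brings the boundary \<open>b\<close> down to \<open>1\<close>.\<close>

primrec jumps :: "real \<Rightarrow> (real \<times> real) list \<Rightarrow> real \<Rightarrow> real" where
  "jumps d [] a = 1"
| "jumps d (\<kappa>b # l) a =
     (1 - fst \<kappa>b) * (indicator {snd \<kappa>b - 1..} a * jumps d l a) +
     fst \<kappa>b * (indicator {snd \<kappa>b - 1..} (a + d) * jumps d l (a + d))"

lemma jumps_bounds:
  assumes "\<forall>\<kappa>b\<in>set l. 0 \<le> fst \<kappa>b \<and> fst \<kappa>b \<le> 1"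
  shows "0 \<le> jumps d l a \<and> jumps d l a \<le> 1"
  using assms
proof (induction l arbitrary: a)
  case (Cons \<kappa>b l)
  obtain \<kappa> b where \<kappa>b: "\<kappa>b = (\<kappa>, b)" by force
  have k: "0 \<le> \<kappa>" "\<kappa> \<le> 1" using Cons.prems \<kappa>b by auto
  have *: "0 \<le> indicator {b - 1..} a * jumps d l a" "indicator {b - 1..} a * jumps d l a \<le> 1" for a
    using Cons.IH[of a] Cons.prems by (auto simp: indicator_def)
  have "(1 - \<kappa>) * (indicator {b - 1..} a * jumps d l a) +
     \<kappa> * (indicator {b - 1..} (a + d) * jumps d l (a + d)) \<le> (1 - \<kappa>) * 1 + \<kappa> * 1"
    by (intro add_mono mult_left_mono *) (use k in auto)
  then show ?case using k *[of a] *[of "a + d"] by (simp add: \<kappa>b)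
qed simp

text \<open>For independent Bernoulli(\<open>\<kappa>\<^sub>j\<close>) variables \<open>B\<^sub>j\<close>, the process \<open>exp (\<Sum>\<^sub>j (\<kappa>\<^sub>j / 2 - B\<^sub>j))\<close> is a
  supermartingale; this is its maximal inequality.\<close>

lemma jumps_lower_bound:
  assumes "\<forall>\<kappa>b\<in>set l. 0 \<le> fst \<kappa>b \<and> fst \<kappa>b \<le> 1" and "0 \<le> d"
    and "\<And>i. i < length l \<Longrightarrow>
      snd (l ! i) - 1 \<le> a \<or> snd (l ! i) - 1 \<le> a + d * ((\<Sum>j\<le>i. fst (l ! j)) / 2 - r)"
  shows "1 - exp (- r) \<le> jumps d l a"
  using assms
proof (induction l arbitrary: a r)
  case Nil
  then show ?case by simp
next
  case (Cons \<kappa>b l)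
  obtain \<kappa> b where \<kappa>b: "\<kappa>b = (\<kappa>, b)" by force
  have k: "0 \<le> \<kappa>" "\<kappa> \<le> 1" using Cons.prems \<kappa>b by auto
  have kl: "\<forall>\<kappa>b\<in>set l. 0 \<le> fst \<kappa>b \<and> fst \<kappa>b \<le> 1" using Cons.prems by auto
  note d = \<open>0 \<le> d\<close>
  have split: "(\<Sum>j\<le>Suc i. fst ((\<kappa>b # l) ! j)) = \<kappa> + (\<Sum>j\<le>i. fst (l ! j))" for i
    by (subst sum.atMost_Suc_shift) (simp add: \<kappa>b)
  have thr: "snd (l ! i) - 1 \<le> a \<or> snd (l ! i) - 1 \<le> a + d * ((\<kappa> + (\<Sum>j\<le>i. fst (l ! j))) / 2 - r)"
    if "i < length l" for i
    using Cons.prems(3)[of "Suc i"] that unfolding split by simp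
  have thr0: "b - 1 \<le> a \<or> b - 1 \<le> a + d * (\<kappa> / 2 - r)"
    using Cons.prems(3)[of 0] by (simp add: \<kappa>b)
  have nonneg: "0 \<le> indicator {b - 1..} a * jumps d l a" for a
    using jumps_bounds[of l d a, OF kl] by (auto simp: indicator_def)
  show ?case
  proof (cases "r \<le> 0")
    case True
    then have "1 - exp (- r) \<le> 0" by simp
    also have "0 \<le> jumps d (\<kappa>b # l) a"
      using jumps_bounds[of "\<kappa>b # l" d a] Cons.prems(1) by blast
    finally show ?thesis .
  next
    case False
    \<comment> \<open>Without a jump the margin \<open>r\<close> shrinks to
      \<open>r - \<kappa> / 2\<close>. If this is negative the claimed bound is trivial; otherwise
      the hypothesis at the first index gives \<open>b - 1 \<le> a\<close>.\<close>
    have A: "1 - exp (- r + \<kappa> / 2) \<le> indicator {b - 1..} a * jumps d l a"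
    proof (cases "r < \<kappa> / 2")
      case True
      then have "1 - exp (- r + \<kappa> / 2) \<le> 0" by simp
      then show ?thesis using nonneg[of a] by linarith
    next
      case False
      then have "d * (\<kappa> / 2 - r) \<le> 0" using d by (intro mult_nonneg_nonpos) auto
      then have "b - 1 \<le> a" using thr0 by linarith
      moreover have "1 - exp (- (r - \<kappa> / 2)) \<le> jumps d l a"
        by (rule Cons.IH[OF kl d]) (use thr in \<open>auto simp: algebra_simps add_divide_distrib\<close>)
      ultimately show ?thesis by simp
    qed
    \<comment> \<open>A jump changes the margin to \<open>r - \<kappa> / 2 + 1\<close>. As
      \<open>\<kappa> / 2 - r \<le> 1\<close>, a rise by \<open>d\<close> also clears the present
      threshold.\<close>
    have "d * (\<kappa> / 2 - r) \<le> d * 1" using k False d by (intro mult_left_mono) auto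
    then have "b - 1 \<le> a + d" using thr0 d by linarith
    moreover have "1 - exp (- (r - \<kappa> / 2 + 1)) \<le> jumps d l (a + d)"
    proof (rule Cons.IH[OF kl d])
      fix i assume "i < length l"
      from thr[OF this] d show "snd (l ! i) - 1 \<le> a + d \<or> 
          snd (l ! i) - 1 \<le> a + d + d * ((\<Sum>j\<le>i. fst (l ! j)) / 2 - (r - \<kappa> / 2 + 1))"
        by (auto simp: algebra_simps add_divide_distrib)
    qed
    ultimately have B: "1 - exp (- r + \<kappa> / 2 - 1) \<le> indicator {b - 1..} (a + d) * jumps d l (a + d)"
      by (simp add: algebra_simps)
    \<comment> \<open>The supermartingale step: \<open>exp (-1) \<le> 1 / 2\<close> bounds the mean
      of \<open>exp\<close> of minus a Bernoulli variable by
      \<open>1 - \<kappa> / 2 \<le> exp (- (\<kappa> / 2))\<close>. Hence only half of the mean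
      enters the margin.\<close>
    have e1: "exp (-1::real) \<le> 1 / 2"
      using exp_ge_add_one_self[of "1::real"] by (simp add: exp_minus field_simps)
    have "1 - \<kappa> + \<kappa> * exp (-1) \<le> 1 + (- (\<kappa> / 2))"
      using mult_left_mono[OF e1 k(1)] by simp
    also have "\<dots> \<le> exp (- (\<kappa> / 2))" by (rule exp_ge_add_one_self)
    finally have "exp (- r + \<kappa> / 2) * (1 - \<kappa> + \<kappa> * exp (-1)) \<le> exp (- r + \<kappa> / 2) * exp (- (\<kappa> / 2))"
      by (intro mult_left_mono) auto
    also have "\<dots> = exp (- r)" by (simp flip: exp_add)
    finally have "exp (- r + \<kappa> / 2) * (1 - \<kappa> + \<kappa> * exp (-1)) \<le> exp (- r)" .
    moreover have "exp (- r + \<kappa> / 2 - 1) = exp (- r + \<kappa> / 2) * exp (-1)"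
      by (simp flip: exp_add)
    ultimately have "1 - exp (- r) \<le> (1 - \<kappa>) * (1 - exp (- r + \<kappa> / 2)) + \<kappa> * (1 - exp (- r + \<kappa> / 2 - 1))"
      by (simp add: algebra_simps)
    also have "\<dots> \<le> (1 - \<kappa>) * (indicator {b - 1..} a * jumps d l a) + \<kappa> * (indicator {b - 1..} (a + d) * jumps d l (a + d))"
      by (intro add_mono mult_left_mono A B) (use k in auto)
    finally show ?thesis by (simp add: \<kappa>b)
  qed
qed

context real_distribution
begin

text \<open>The coupling: a step is replaced, with probability \<open>\<kappa>\<close>, by an independent one conditioned to be
  at most \<open>- 2 * d\<close>. Unless the replaced step was itself at most \<open>- d\<close>, this lowers the walk by at
  least \<open>d\<close>.\<close>

lemma wstay_coupling:
  assumes "\<forall>\<kappa>b\<in>set l. 0 \<le> fst \<kappa>b \<and> fst \<kappa>b \<le> 1" and d: "0 < d" and m: "0 < prob {..- 2 * d}"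
  shows "wstay M (map (\<lambda>(\<kappa>, b). (\<lambda>_. 1, b)) l) x * jumps d l a
     \<le> wstay M (map (\<lambda>(\<kappa>, b). (tilt d \<kappa>, 1)) l) (x - a) + sum_list (map fst l) * prob {..- d}"
  using assms(1)
proof (induction l arbitrary: x a)
  case Nil
  then show ?case by simp
next
  case (Cons \<kappa>b l)
  obtain \<kappa> b where \<kappa>b: "\<kappa>b = (\<kappa>, b)" by force
  have k: "0 \<le> \<kappa>" "\<kappa> \<le> 1" using Cons.prems \<kappa>b by auto
  have kl: "\<forall>\<kappa>b\<in>set l. 0 \<le> fst \<kappa>b \<and> fst \<kappa>b \<le> 1" using Cons.prems by auto
  define l1 where "l1 = map (\<lambda>(\<kappa>, b). (\<lambda>_::real. 1::real, b)) l"
  define l2 where "l2 = map (\<lambda>(\<kappa>, b::real). (tilt d \<kappa>, 1::real)) l"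
  have w1: "\<forall>zb\<in>set l1. weight M (fst zb)" using weight_one by (auto simp: l1_def)
  have w2: "\<forall>zb\<in>set l2. weight M (fst zb)" using weight_tilt[OF _ _ m] kl by (auto simp: l2_def)
  define s where "s = sum_list (map fst l) * prob {..- d}"
  have s: "0 \<le> s" using kl by (auto simp: s_def case_prod_beta intro!: mult_nonneg_nonneg sum_list_nonneg)
  define F where "F u = indicator {..b} u * wstay M l1 u" for u
  define H where "H u = indicator {..1} u * wstay M l2 u" for u
  define I :: "real \<Rightarrow> real" where "I = indicator {..- 2 * d}"
  define mJ where "mJ = prob {..- 2 * d}"
  note F = wstay_step[where l = l1 and b = b, OF w1, folded F_def]
  note H = wstay_step[where l = l2 and b = 1, OF w2, folded H_def]
  have intc: "integrable M (indicator A :: real \<Rightarrow> real)" if "A \<in> sets borel" for A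
    by (rule integrable_const_bound[where B = 1]) (use that in \<open>auto simp: borel_measurable_M\<close>)
  have intF: "integrable M (\<lambda>y. F (x + y))" using F(5)[of "\<lambda>_. 1" x] by simp
  have intH: "integrable M (\<lambda>y. H (x - a + y))" using H(5)[of "\<lambda>_. 1" "x - a"] by simp
  have intIH: "integrable M (\<lambda>y. I y * H (x - a + y))" 
    using H(5)[of I "x - a"] intc[of "{..- 2 * d}"] by (simp add: I_def)
  define hb where "hb = (\<integral>y. I y * H (x - a + y) \<partial>M) / mJ"
  have hb0: "0 \<le> hb" unfolding hb_def mJ_def
    by (intro divide_nonneg_nonneg integral_nonneg_AE) (use H(2) in \<open>auto simp: I_def\<close>)
  have J: "0 \<le> jumps d l u" "jumps d l u \<le> 1" for u using jumps_bounds[OF kl] by auto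
  have IH: "wstay M l1 u * jumps d l v \<le> wstay M l2 (u - v) + s" for u v
    using Cons.IH[OF kl] by (simp add: l1_def l2_def s_def)
  \<comment> \<open>Since \<open>u \<le> b\<close> and \<open>b - 1 \<le> v\<close> imply
    \<open>u - v \<le> 1\<close>, subtracting the jumps turns the boundary \<open>b\<close> into 1;
    in every other case the left side is 0.\<close>
  have both: "F u * (indicator {b - 1..} v * jumps d l v) \<le> H (u - v) + s" for u v
  proof (cases "u \<le> b \<and> b - 1 \<le> v")
    case True
    then show ?thesis using IH[of u v] by (simp add: F_def H_def)
  next
    case False
    then show ?thesis using s H(2)[of "u - v"] by (auto simp: F_def indicator_def)
  qed
  have both1: "F u * (indicator {b - 1..} v * jumps d l v) \<le> 1" for u v
  proof -
    have "F u * (indicator {b - 1..} v * jumps d l v) \<le> 1 * 1"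
      by (intro mult_mono) (use F(2,3)[of u] J[of v] in \<open>auto simp: indicator_def\<close>)
    then show ?thesis by simp
  qed
  \<comment> \<open>For \<open>y > - d\<close> every value up to \<open>- 2 * d\<close> lies below
    \<open>y - d\<close>, so antitonicity of \<open>H\<close> compares pointwise. Steps
    \<open>y \<le> - d\<close> are given up at the cost of the indicator.\<close>
  have jump: "F (x + y) * (indicator {b - 1..} (a + d) * jumps d l (a + d)) \<le> hb + s + indicator {..- d} y" for y
  proof (cases "y \<le> - d")
    case True
    then show ?thesis using both1[of "x + y" "a + d"] hb0 s by simp
  next
    case False
    have "H (x - a + y - d) * mJ = (\<integral>\<eta>. I \<eta> * H (x - a + y - d) \<partial>M)"
      by (simp add: I_def mJ_def)
    also have "\<dots> \<le> (\<integral>\<eta>. I \<eta> * H (x - a + \<eta>) \<partial>M)"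
    proof (rule integral_mono[OF _ intIH])
      show "integrable M (\<lambda>\<eta>. I \<eta> * H (x - a + y - d))"
        using intc[of "{..- 2 * d}"] by (auto simp: I_def)
      show "I \<eta> * H (x - a + y - d) \<le> I \<eta> * H (x - a + \<eta>)" for \<eta>
        using False d H(1) by (auto simp: I_def indicator_def antimono_def)
    qed
    finally have "H (x - a + y - d) \<le> hb" using m by (simp add: hb_def mJ_def field_simps)
    then show ?thesis using both[of "x + y" "a + d"] False by (simp add: algebra_simps)
  qed
  have "wstay M (map (\<lambda>(\<kappa>, b). (\<lambda>_. 1, b)) (\<kappa>b # l)) x * jumps d (\<kappa>b # l) a
     = (\<integral>y. F (x + y) * jumps d (\<kappa>b # l) a \<partial>M)"
    by (simp add: \<kappa>b F_def l1_def)
  also have "\<dots> \<le> (\<integral>y. (1 - \<kappa>) * (H (x - a + y) + s) + \<kappa> * (hb + s + indicator {..- d} y) \<partial>M)"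
  proof (rule integral_mono)
    show "integrable M (\<lambda>y. F (x + y) * jumps d (\<kappa>b # l) a)" using intF by auto
    show "integrable M (\<lambda>y. (1 - \<kappa>) * (H (x - a + y) + s) + \<kappa> * (hb + s + indicator {..- d} y))"
      using intH intc[of "{..-d}"] by auto
    fix y
    have "F (x + y) * jumps d (\<kappa>b # l) a = (1 - \<kappa>) * (F (x + y) * (indicator {b - 1..} a * jumps d l a)) +
       \<kappa> * (F (x + y) * (indicator {b - 1..} (a + d) * jumps d l (a + d)))"
      by (simp add: \<kappa>b algebra_simps)
    also have "\<dots> \<le> (1 - \<kappa>) * (H (x - a + y) + s) + \<kappa> * (hb + s + indicator {..- d} y)"
      using both[of "x + y" a] by (intro add_mono mult_left_mono jump) (use k in \<open>auto simp: algebra_simps\<close>)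
    finally show "F (x + y) * jumps d (\<kappa>b # l) a \<le> \<dots>" .
  qed
  also have "\<dots> = (1 - \<kappa>) * (\<integral>y. H (x - a + y) \<partial>M) + \<kappa> * hb + s + \<kappa> * prob {..- d}"
    using intH intc[of "{..-d}"] prob_space by (simp add: algebra_simps)
  also have "(1 - \<kappa>) * (\<integral>y. H (x - a + y) \<partial>M) + \<kappa> * hb = (\<integral>y. (1 - \<kappa>) * H (x - a + y) + \<kappa> / mJ * (I y * H (x - a + y)) \<partial>M)"
    using intH intIH by (simp add: hb_def)
  also have "\<dots> = (\<integral>y. tilt d \<kappa> y * H (x - a + y) \<partial>M)"
    by (intro Bochner_Integration.integral_cong) (auto simp: tilt_def I_def mJ_def algebra_simps)
  finally show ?case
    by (simp add: \<kappa>b H_def l2_def s_def algebra_simps)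
qed

end

section \<open>Levy processes on a grid\<close>

lemma sets_partial_sums_le:
  fixes N :: "real measure"
  assumes "sets N = sets borel"
  shows "{w \<in> space (PiM {m..<n} (\<lambda>_. N)). \<forall>k\<in>{m..<n}. x + (\<Sum>i=m..k. w i) \<le> g k} \<in> sets (PiM {m..<n::nat} (\<lambda>_. N))"
proof (rule sets.sets_Collect_countable_All')
  fix k assume k: "k \<in> {m..<n}"
  have "(\<lambda>w. w i) \<in> borel_measurable (PiM {m..<n} (\<lambda>_. N))" if "i \<in> {m..k}" for i
    using measurable_component_singleton[of i "{m..<n}" "\<lambda>_. N"] that k
    unfolding measurable_cong_sets[OF refl assms] by auto
  then have "(\<lambda>w. x + (\<Sum>i=m..k. w i)) \<in> borel_measurable (PiM {m..<n} (\<lambda>_. N))"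
    by (intro borel_measurable_add borel_measurable_sum borel_measurable_const)
  then show "{w \<in> space (PiM {m..<n} (\<lambda>_. N)). x + (\<Sum>i=m..k. w i) \<le> g k} \<in> sets (PiM {m..<n} (\<lambda>_. N))"
    by (rule borel_measurable_le[OF _ borel_measurable_const])
qed simp

lemma sets_Collect_le_lessThan:
  fixes Y :: "nat \<Rightarrow> 'a \<Rightarrow> real"
  assumes "\<And>k. Y k \<in> borel_measurable M"
  shows "{\<omega> \<in> space M. \<forall>k<n. Y k \<omega> \<le> b k} \<in> sets M"
proof -
  have "{\<omega> \<in> space M. \<forall>k\<in>{..<n}. Y k \<omega> \<le> b k} \<in> sets M"
  proof (rule sets.sets_Collect_countable_All')
    show "{\<omega> \<in> space M. Y k \<omega> \<le> b k} \<in> sets M" for k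
      by (rule borel_measurable_le[OF assms borel_measurable_const])
  qed simp
  then show ?thesis by (simp only: Ball_def lessThan_iff)
qed

text \<open>The first coordinate is integrated separately: given its value \<open>y\<close>, what
  remains is the event for a walk from \<open>x + y\<close> with one step fewer, which is the
  recursion of \<open>wstay\<close>. The induction therefore lowers \<open>m\<close> from
  \<open>n\<close>.\<close>

lemma (in real_distribution) emeasure_partial_sums:
  assumes "m \<le> n"
  shows "emeasure (PiM {m..<n} (\<lambda>_. M)) {w \<in> space (PiM {m..<n} (\<lambda>_. M)). \<forall>k\<in>{m..<n}. x + (\<Sum>i=m..k. w i) \<le> g k}
     = ennreal (wstay M (map (\<lambda>k. (\<lambda>_. 1, g k)) [m..<n]) x)"
  using assms
proof (induction m arbitrary: x rule: inc_induct)
  case base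
  interpret P: prob_space "PiM {} (\<lambda>_::nat. M)" by (rule prob_space_PiM) (rule prob_space_axioms)
  show ?case using P.emeasure_space_1 by simp
next
  case (step m)
  interpret product_sigma_finite "\<lambda>_::nat. M"
    by unfold_locales
  define E where "E m x = {w \<in> space (PiM {m..<n} (\<lambda>_. M)). \<forall>k\<in>{m..<n}. x + (\<Sum>i=m..k. w i) \<le> g k}" for m x
  define W where "W = wstay M (map (\<lambda>k. (\<lambda>_::real. 1::real, g k)) [Suc m..<n])"
  have w: "\<forall>zb\<in>set (map (\<lambda>k. (\<lambda>_::real. 1::real, g k)) [Suc m..<n]). weight M (fst zb)"
    using weight_one by auto
  have ins: "{m..<n} = insert m {Suc m..<n}" using step.hyps by auto
  have Em[measurable]: "E m x \<in> sets (PiM {m..<n} (\<lambda>_. M))" for m x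
    unfolding E_def by (rule sets_partial_sums_le) simp
  have IH: "emeasure (PiM {Suc m..<n} (\<lambda>_. M)) (E (Suc m) u) = ennreal (W u)" for u
    unfolding E_def W_def by (rule step.IH)
  have W0: "0 \<le> indicator {..g m} u * W u" for u
    unfolding W_def by (rule wstay_step(2)[OF w])
  have W_int: "integrable M (\<lambda>y. 1 * (indicator {..g m} (x + y) * W (x + y)))" for x
    unfolding W_def by (rule wstay_step(5)[OF w]) simp
  have "emeasure (PiM {m..<n} (\<lambda>_. M)) (E m x) = (\<integral>\<^sup>+ w. indicator (E m x) w \<partial>PiM (insert m {Suc m..<n}) (\<lambda>_. M))"
    unfolding ins[symmetric] by (rule nn_integral_indicator[OF Em, symmetric])
  also have "\<dots> = (\<integral>\<^sup>+ y. (\<integral>\<^sup>+ w. indicator (E m x) (w(m := y)) \<partial>PiM {Suc m..<n} (\<lambda>_. M)) \<partial>M)"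
    by (rule product_nn_integral_insert_rev) (simp, simp, unfold ins[symmetric], rule borel_measurable_indicator[OF Em])
  also have "\<dots> = (\<integral>\<^sup>+ y. ennreal (1 * (indicator {..g m} (x + y) * W (x + y))) \<partial>M)"
  proof (rule nn_integral_cong)
    fix y
    have *: "indicator (E m x) (w(m := y)) = (indicator {..g m} (x + y) * indicator (E (Suc m) (x + y)) w :: ennreal)"
      if w: "w \<in> space (PiM {Suc m..<n} (\<lambda>_. M))" for w
    proof -
      have sp: "w(m := y) \<in> space (PiM {m..<n} (\<lambda>_. M))"
        using w unfolding ins space_PiM by (intro PiE_fun_upd) auto
      have sum0: "(\<Sum>i=m..m. (w(m := y)) i) = y" by simp
      have sum: "(\<Sum>i=m..k. (w(m := y)) i) = y + (\<Sum>i=Suc m..k. w i)" if "m < k" for k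
      proof -
        have "(\<Sum>i=m..k. (w(m := y)) i) = (w(m := y)) m + (\<Sum>i=Suc m..k. (w(m := y)) i)"
          by (rule sum.atLeast_Suc_atMost) (use that in simp)
        also have "(\<Sum>i=Suc m..k. (w(m := y)) i) = (\<Sum>i=Suc m..k. w i)"
          by (rule sum.cong) auto
        finally show ?thesis by simp
      qed
      have "(\<forall>k\<in>{m..<n}. x + (\<Sum>i=m..k. (w(m := y)) i) \<le> g k) \<longleftrightarrow>
         x + y \<le> g m \<and> (\<forall>k\<in>{Suc m..<n}. x + y + (\<Sum>i=Suc m..k. w i) \<le> g k)"
      proof -
        have "(\<forall>k\<in>{Suc m..<n}. x + (\<Sum>i=m..k. (w(m := y)) i) \<le> g k) \<longleftrightarrow>
          (\<forall>k\<in>{Suc m..<n}. x + y + (\<Sum>i=Suc m..k. w i) \<le> g k)"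
        proof (intro ball_cong refl)
          fix k assume "k \<in> {Suc m..<n}"
          then have "m < k" by simp
          show "(x + (\<Sum>i=m..k. (w(m := y)) i) \<le> g k) = (x + y + (\<Sum>i=Suc m..k. w i) \<le> g k)"
            unfolding sum[OF \<open>m < k\<close>] by (simp only: add.assoc)
        qed
        then show ?thesis unfolding ins ball_simps sum0 by simp
      qed
      then have "w(m := y) \<in> E m x \<longleftrightarrow> x + y \<le> g m \<and> w \<in> E (Suc m) (x + y)"
        using sp w by (simp only: E_def mem_Collect_eq simp_thms)
      then show ?thesis by (simp add: indicator_def)
    qed
    have "(\<integral>\<^sup>+ w. indicator (E m x) (w(m := y)) \<partial>PiM {Suc m..<n} (\<lambda>_. M))
       = (\<integral>\<^sup>+ w. indicator {..g m} (x + y) * indicator (E (Suc m) (x + y)) w \<partial>PiM {Suc m..<n} (\<lambda>_. M))"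
      by (rule nn_integral_cong) (rule *)
    also have "\<dots> = indicator {..g m} (x + y) * emeasure (PiM {Suc m..<n} (\<lambda>_. M)) (E (Suc m) (x + y))"
      unfolding nn_integral_cmult[OF borel_measurable_indicator[OF Em]] nn_integral_indicator[OF Em] ..
    also have "\<dots> = ennreal (1 * (indicator {..g m} (x + y) * W (x + y)))"
      unfolding IH by (simp add: indicator_def)
    finally show "(\<integral>\<^sup>+ w. indicator (E m x) (w(m := y)) \<partial>PiM {Suc m..<n} (\<lambda>_. M)) = \<dots>" .
  qed
  also have "\<dots> = ennreal (\<integral>y. 1 * (indicator {..g m} (x + y) * W (x + y)) \<partial>M)"
    by (rule nn_integral_eq_integral[OF W_int]) (rule AE_I2, simp only: mult_1_left W0)
  also have "\<dots> = ennreal (wstay M (map (\<lambda>k. (\<lambda>_. 1, g k)) [m..<n]) x)"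
    using step.hyps by (simp add: upt_conv_Cons W_def)
  finally show ?case by (simp add: E_def)
qed

context levy_process
begin

lemma sets_grid:
  fixes t :: "nat \<Rightarrow> real"
  assumes "\<And>k. 0 \<le> t k"
  shows "{\<omega> \<in> space M. \<forall>k<n. X (t k) \<omega> \<le> b k} \<in> sets M"
  by (rule sets_Collect_le_lessThan) (rule random_variable_X[OF assms])

lemma real_distribution_X: "0 \<le> t \<Longrightarrow> real_distribution (distr M borel (X t))"
  using random_variable_X by (intro real_distribution_distr) auto

text \<open>The increments over the cells of the grid are independent with the law of
  \<open>X h\<close>, and their partial sums telescope. The initial value \<open>X 0\<close> drops
  out on a set of probability 1.\<close>

lemma prob_grid:
  assumes "0 < h" "0 < n"
  shows "prob {\<omega> \<in> space M. \<forall>k<n. X (real (Suc k) * h) \<omega> \<le> g k}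
    = wstay (distr M borel (X h)) (map (\<lambda>k. (\<lambda>_. 1, g k)) [0..<n]) 0"
proof -
  let ?\<mu> = "distr M borel (X h)"
  define \<xi> where "\<xi> i \<omega> = X (real (Suc i) * h) \<omega> - X (real i * h) \<omega>" for i \<omega>
  interpret \<mu>: real_distribution ?\<mu> using assms by (intro real_distribution_X) auto
  have hk: "0 \<le> real k * h" for k using assms by simp
  have \<xi>m[measurable]: "\<xi> i \<in> borel_measurable M" for i
    unfolding \<xi>_def[abs_def] by (intro borel_measurable_diff random_variable_X hk)
  have X0: "distr M borel (\<lambda>\<omega>. X h \<omega> - X 0 \<omega>) = ?\<mu>"
    using start_zero assms by (intro distr_cong_AE borel_measurable_diff random_variable_X) auto
  have d\<xi>: "distr M borel (\<xi> i) = ?\<mu>" for i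
    using stationary_increments[of "real i * h" h] assms unfolding X0[symmetric]
    by (simp add: \<xi>_def[abs_def] algebra_simps)
  have ind: "indep_vars (\<lambda>_. borel) \<xi> {..<n}"
    using independent_increments[of "\<lambda>i. real i * h" n] assms by (simp add: \<xi>_def[abs_def])
  have joint: "distr M (PiM {..<n} (\<lambda>_. borel)) (\<lambda>\<omega>. \<lambda>i\<in>{..<n}. \<xi> i \<omega>) = PiM {..<n} (\<lambda>_. ?\<mu>)"
  proof -
    have "{..<n} \<noteq> {}" using assms by auto
    from indep_vars_iff_distr_eq_PiM[where M' = "\<lambda>_. borel" and X = \<xi>, OF this \<xi>m] ind
    show ?thesis unfolding d\<xi> by blast
  qed
  have lt: "{0..<n} = {..<n}" by auto
  define E where "E = {w \<in> space (PiM {0..<n} (\<lambda>_. ?\<mu>)). \<forall>k\<in>{0..<n}. 0 + (\<Sum>i=0..k. w i) \<le> g k}"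
  have sp: "space (PiM {0..<n} (\<lambda>_. ?\<mu>)) = space (PiM {..<n} (\<lambda>_. borel))"
    by (simp add: space_PiM lt)
  have Em: "E \<in> sets (PiM {..<n} (\<lambda>_. borel))"
    using sets_partial_sums_le[of borel 0 n 0 g] unfolding E_def sp unfolding lt by simp
  have "emeasure (PiM {0..<n} (\<lambda>_. ?\<mu>)) E = emeasure M ((\<lambda>\<omega>. \<lambda>i\<in>{..<n}. \<xi> i \<omega>) -` E \<inter> space M)"
    unfolding lt joint[symmetric] by (rule emeasure_distr[OF _ Em]) measurable
  also have "(\<lambda>\<omega>. \<lambda>i\<in>{..<n}. \<xi> i \<omega>) -` E \<inter> space M = {\<omega> \<in> space M. \<forall>k<n. X (real (Suc k) * h) \<omega> - X 0 \<omega> \<le> g k}"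
  proof -
    have "(\<Sum>i=0..k. (\<lambda>i\<in>{..<n}. \<xi> i \<omega>) i) = X (real (Suc k) * h) \<omega> - X 0 \<omega>" if "k < n" for k \<omega>
    proof -
      have "(\<Sum>i=0..k. (\<lambda>i\<in>{..<n}. \<xi> i \<omega>) i) = (\<Sum>i<Suc k. \<xi> i \<omega>)"
        using that by (intro sum.cong) auto
      also have "\<dots> = X (real (Suc k) * h) \<omega> - X 0 \<omega>"
        unfolding \<xi>_def using sum_lessThan_telescope[of "\<lambda>i. X (real i * h) \<omega>" "Suc k"]
        by (simp only: of_nat_0 mult_zero_left)
      finally show ?thesis .
    qed
    then have "(\<forall>k\<in>{0..<n}. 0 + (\<Sum>i=0..k. (\<lambda>i\<in>{..<n}. \<xi> i \<omega>) i) \<le> g k) \<longleftrightarrow>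
       (\<forall>k<n. X (real (Suc k) * h) \<omega> - X 0 \<omega> \<le> g k)" for \<omega>
      by (simp only: Ball_def atLeastLessThan_iff add_0_left) (metis le0)
    moreover have "(\<lambda>i\<in>{..<n}. \<xi> i \<omega>) \<in> space (PiM {..<n} (\<lambda>_. borel))" for \<omega>
      by (simp add: space_PiM)
    ultimately show ?thesis unfolding E_def sp by (simp only: vimage_def mem_Collect_eq) blast
  qed
  finally have "emeasure M {\<omega> \<in> space M. \<forall>k<n. X (real (Suc k) * h) \<omega> - X 0 \<omega> \<le> g k}
     = ennreal (wstay ?\<mu> (map (\<lambda>k. (\<lambda>_. 1, g k)) [0..<n]) 0)"
    using \<mu>.emeasure_partial_sums[of 0 n 0 g] by (simp add: E_def)
  moreover have "emeasure M {\<omega> \<in> space M. \<forall>k<n. X (real (Suc k) * h) \<omega> - X 0 \<omega> \<le> g k}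
     = emeasure M {\<omega> \<in> space M. \<forall>k<n. X (real (Suc k) * h) \<omega> \<le> g k}"
  proof (rule emeasure_eq_AE)
    show "AE \<omega> in M. \<omega> \<in> {\<omega> \<in> space M. \<forall>k<n. X (real (Suc k) * h) \<omega> - X 0 \<omega> \<le> g k} \<longleftrightarrow>
      \<omega> \<in> {\<omega> \<in> space M. \<forall>k<n. X (real (Suc k) * h) \<omega> \<le> g k}"
      using start_zero by eventually_elim auto
    show "{\<omega> \<in> space M. \<forall>k<n. X (real (Suc k) * h) \<omega> \<le> g k} \<in> sets M"
      by (rule sets_grid[OF hk])
    show "{\<omega> \<in> space M. \<forall>k<n. X (real (Suc k) * h) \<omega> - X 0 \<omega> \<le> g k} \<in> sets M"
      by (rule sets_Collect_le_lessThan) (rule borel_measurable_diff[OF random_variable_X[OF hk]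
              random_variable_X[OF order_refl]])
  qed
  moreover have "0 \<le> wstay ?\<mu> (map (\<lambda>k. (\<lambda>_. 1, g k)) [0..<n]) 0"
    using \<mu>.wstay_props[of "map (\<lambda>k. (\<lambda>_. 1, g k)) [0..<n]"] \<mu>.weight_one by auto
  ultimately show ?thesis by (simp add: emeasure_eq_measure)
qed

section \<open>From the grid to continuous time\<close>

text \<open>By right-continuity a violation at \<open>t < T\<close> persists just to the right of
  \<open>t\<close>, where \<open>D\<close> has a point. No such argument is available at the
  endpoint \<open>T\<close>, so it must belong to \<open>D\<close>.\<close>

lemma (in -) below_iff_below_dense:
  assumes x: "cadlag x" and g: "continuous_on {0..} g"
    and D: "D \<subseteq> {0..T}" "T \<in> D" "\<And>t u. 0 \<le> t \<Longrightarrow> t < T \<Longrightarrow> t < u \<Longrightarrow> \<exists>s\<in>D. t < s \<and> s < u"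
  shows "(\<forall>t\<in>{0..T}. x t \<le> g t) \<longleftrightarrow> (\<forall>t\<in>D. x t \<le> g t)"
proof
  assume *: "\<forall>t\<in>D. x t \<le> g t"
  show "\<forall>t\<in>{0..T}. x t \<le> g t"
  proof
    fix t assume t: "t \<in> {0..T}"
    show "x t \<le> g t"
    proof (cases "t = T")
      case True
      then show ?thesis using * D(2) by auto
    next
      case False
      have "(g \<longlongrightarrow> g t) (at t within {0..})" using g t by (auto simp: continuous_on_def)
      then have "(g \<longlongrightarrow> g t) (at_right t)" by (rule tendsto_within_subset) (use t in auto)
      moreover have "(x \<longlongrightarrow> x t) (at_right t)" using x t by (auto simp: cadlag_def)
      ultimately have lim: "((\<lambda>s. x s - g s) \<longlongrightarrow> x t - g t) (at_right t)" by (intro tendsto_diff)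
      show ?thesis
      proof (rule ccontr)
        assume "\<not> x t \<le> g t"
        then have "\<forall>\<^sub>F s in at_right t. x s - g s > 0" by (intro order_tendstoD(1)[OF lim]) auto
        then obtain u where "t < u" "\<And>s. t < s \<Longrightarrow> s < u \<Longrightarrow> x s - g s > 0"
          by (auto simp: eventually_at_right_field)
        moreover obtain s where "s \<in> D" "t < s" "s < u" using D(3)[of t u] t False \<open>t < u\<close> by auto
        ultimately show False using * by force
      qed
    qed
  qed
qed (use D(1) in auto)

lemma measure_below_dense:
  assumes g: "continuous_on {0..} g" and "countable D"
    and D: "D \<subseteq> {0..T}" "T \<in> D" "\<And>t u. 0 \<le> t \<Longrightarrow> t < T \<Longrightarrow> t < u \<Longrightarrow> \<exists>s\<in>D. t < s \<and> s < u"
  shows "{\<omega> \<in> space M. \<forall>t\<in>{0..T}. X t \<omega> \<le> g t} \<in> sets (completion M)"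
    and "prob_below M X g T = prob {\<omega> \<in> space M. \<forall>t\<in>D. X t \<omega> \<le> g t}"
proof -
  have X: "X t \<in> borel_measurable M" if "t \<in> D" for t using random_variable_X that D(1) by auto
  have m: "{\<omega> \<in> space M. \<forall>t\<in>D. X t \<omega> \<le> g t} \<in> sets M"
  proof (rule sets.sets_Collect_countable_All'[OF _ \<open>countable D\<close>])
    show "{\<omega> \<in> space M. X t \<omega> \<le> g t} \<in> sets M" if "t \<in> D" for t
      by (rule borel_measurable_le[OF X[OF that] borel_measurable_const])
  qed
  have "AE \<omega> in completion M. cadlag (\<lambda>t. X t \<omega>)" using cadlag_paths by (rule AE_completion)
  then have ae: "AE \<omega> in completion M. \<omega> \<in> {\<omega> \<in> space M. \<forall>t\<in>D. X t \<omega> \<le> g t} \<longleftrightarrow>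
     \<omega> \<in> {\<omega> \<in> space M. \<forall>t\<in>{0..T}. X t \<omega> \<le> g t}"
  proof eventually_elim
    case (elim \<omega>)
    show ?case by (simp only: mem_Collect_eq below_iff_below_dense[OF elim g D])
  qed
  interpret c: prob_space "completion M" by (rule prob_space_completion)
  show s: "{\<omega> \<in> space M. \<forall>t\<in>{0..T}. X t \<omega> \<le> g t} \<in> sets (completion M)"
    by (rule completion.in_sets_AE[OF ae sets_completionI_sets[OF m]]) simp
  show "prob_below M X g T = prob {\<omega> \<in> space M. \<forall>t\<in>D. X t \<omega> \<le> g t}"
    unfolding prob_below_def c.finite_measure_eq_AE[OF ae sets_completionI_sets[OF m] s, symmetric]
    by (rule measure_completion[OF m])
qed

lemma prob_below_sets:
  assumes "continuous_on {0..} g" "0 \<le> T"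
  shows "{\<omega> \<in> space M. \<forall>t\<in>{0..T}. X t \<omega> \<le> g t} \<in> sets (completion M)"
proof (rule measure_below_dense(1)[OF assms(1)])
  show "countable (insert T (\<rat> \<inter> {0..T}))"
    by (intro countable_insert countable_Int1 countable_rat)
  fix t u assume t: "0 \<le> t" "t < T" "t < u"
  then have "t < min T u" by simp
  from Rats_dense_in_real[OF this] obtain r where r: "r \<in> \<rat>" "t < r" "r < min T u" by blast
  show "\<exists>s\<in>insert T (\<rat> \<inter> {0..T}). t < s \<and> s < u"
  proof (rule bexI[of _ r])
    show "r \<in> insert T (\<rat> \<inter> {0..T})" using r t by simp
    show "t < r \<and> r < u" using r by simp
  qed
qed (use assms in auto)

lemma prob_below_mono:
  assumes "continuous_on {0..} g" "0 \<le> T" "T \<le> T'" "\<And>t. t \<in> {0..T} \<Longrightarrow> g' t \<le> g t"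
  shows "prob_below M X g' T' \<le> prob_below M X g T"
proof -
  interpret c: prob_space "completion M" by (rule prob_space_completion)
  show ?thesis unfolding prob_below_def
  proof (rule c.finite_measure_mono[OF _ prob_below_sets[OF assms(1,2)]], safe)
    fix \<omega> t assume \<omega>: "\<forall>t\<in>{0..T'}. X t \<omega> \<le> g' t" and t: "t \<in> {0..T}"
    then have "X t \<omega> \<le> g' t" using assms(3) by simp
    then show "X t \<omega> \<le> g t" using assms(4)[OF t] by (rule order_trans)
  qed
qed

lemma prob_below_le_grid:
  assumes "0 < h" "real n * h \<le> T" "\<And>k. k < n \<Longrightarrow> g (real (Suc k) * h) \<le> b k"
  shows "prob_below M X g T \<le> prob {\<omega> \<in> space M. \<forall>k<n. X (real (Suc k) * h) \<omega> \<le> b k}"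
proof -
  interpret c: prob_space "completion M" by (rule prob_space_completion)
  have hk: "0 \<le> real k * h" for k using assms by simp
  have G: "{\<omega> \<in> space M. \<forall>k<n. X (real (Suc k) * h) \<omega> \<le> b k} \<in> sets M"
    by (rule sets_grid[OF hk])
  have "prob_below M X g T \<le> measure (completion M) {\<omega> \<in> space M. \<forall>k<n. X (real (Suc k) * h) \<omega> \<le> b k}"
    unfolding prob_below_def
  proof (rule c.finite_measure_mono)
    show "{\<omega> \<in> space M. \<forall>t\<in>{0..T}. X t \<omega> \<le> g t} \<subseteq> {\<omega> \<in> space M. \<forall>k<n. X (real (Suc k) * h) \<omega> \<le> b k}"
    proof safe
      fix \<omega> k assume \<omega>: "\<forall>t\<in>{0..T}. X t \<omega> \<le> g t" and k: "k < n"
      have "real (Suc k) * h \<le> real n * h" using k assms by (intro mult_right_mono) auto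
      then have "real (Suc k) * h \<le> T" using assms(2) by linarith
      then have "real (Suc k) * h \<in> {0..T}" using hk[of "Suc k"] by (simp del: of_nat_Suc)
      then have "X (real (Suc k) * h) \<omega> \<le> g (real (Suc k) * h)" using \<omega> by blast
      then show "X (real (Suc k) * h) \<omega> \<le> b k" using assms(3)[OF k] by simp
    qed
  qed (rule sets_completionI_sets[OF G])
  then show ?thesis unfolding measure_completion[OF G] .
qed

text \<open>The dyadic grids are nested, so the events decrease, and their intersection is the event
  over all dyadic times in \<open>(0, n]\<close>, a dense set which contains
  \<open>n\<close>.\<close>

lemma grid_limit:
  assumes "continuous_on {0..} g" "0 < n"
  shows "(\<lambda>j. prob {\<omega> \<in> space M. \<forall>k<n * 2 ^ j. X (real (Suc k) * (1 / 2 ^ j)) \<omega> \<le> g (real (Suc k) * (1 / 2 ^ j))})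
     \<longlonglongrightarrow> prob_below M X g (real n)"
proof -
  define t where "t j k = real (Suc k) * (1 / 2 ^ j)" for j k :: nat
  define G where "G j = {\<omega> \<in> space M. \<forall>k<n * 2 ^ j. X (t j k) \<omega> \<le> g (t j k)}" for j
  define D where "D = (\<Union>j. t j ` {..<n * 2 ^ j})"
  have Gm: "G j \<in> sets M" for j unfolding G_def by (rule sets_grid) (simp add: t_def)
  have "decseq G"
  proof (rule decseq_SucI, unfold G_def, safe)
    fix j \<omega> k assume *: "\<forall>k<n * 2 ^ Suc j. X (t (Suc j) k) \<omega> \<le> g (t (Suc j) k)" and k: "k < n * 2 ^ j"
    \<comment> \<open>Index \<open>k\<close> stands for the time \<open>(k + 1) / 2 ^ j\<close>, so
      halving the mesh sends \<open>k\<close> to \<open>2 * k + 1\<close> rather than to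
      \<open>2 * k\<close>.\<close>
    have "t (Suc j) (2 * k + 1) = t j k" by (simp add: t_def field_simps)
    moreover have "2 * k + 1 < n * 2 ^ Suc j" using k by simp
    ultimately show "X (t j k) \<omega> \<le> g (t j k)" using * by metis
  qed
  then have "(\<lambda>j. prob (G j)) \<longlonglongrightarrow> prob (\<Inter>j. G j)" using Gm by (intro finite_Lim_measure_decseq) auto
  moreover have "(\<Inter>j. G j) = {\<omega> \<in> space M. \<forall>t\<in>D. X t \<omega> \<le> g t}"
    by (auto simp: G_def D_def)
  moreover have "prob_below M X g (real n) = prob {\<omega> \<in> space M. \<forall>t\<in>D. X t \<omega> \<le> g t}"
  proof (rule measure_below_dense(2)[OF assms(1)])
    show "countable D" by (auto simp: D_def)
    show "D \<subseteq> {0..real n}"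
    proof
      fix s assume "s \<in> D"
      then obtain j k where s: "s = t j k" "k < n * 2 ^ j" by (auto simp: D_def)
      have "real (Suc k) \<le> real (n * 2 ^ j)" using s by (intro of_nat_mono) auto
      then have "s \<le> real n" using s by (simp add: t_def divide_le_eq del: of_nat_Suc)
      then show "s \<in> {0..real n}" using s by (simp add: t_def)
    qed
    have "t 0 (n - 1) = real n" using assms by (simp add: t_def)
    then show "real n \<in> D" using assms by (auto simp: D_def intro!: exI[of _ 0] image_eqI[of _ _ "n - 1"])
    fix s u :: real assume s: "0 \<le> s" "s < real n" "s < u"
    define v where "v = min u (real n)"
    have v: "s < v" "v \<le> u" "v \<le> real n" using s by (auto simp: v_def)
    obtain j where j: "1 / 2 ^ j < v - s" using real_arch_pow_inv[of "v - s" "1 / 2"] v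
      by (auto simp: power_one_over)
    \<comment> \<open>With this \<open>k\<close>, \<open>t j k\<close> is the first grid time
      strictly after \<open>s\<close>; the mesh was chosen so fine that it precedes
      \<open>v\<close>, hence does not exceed \<open>n\<close>.\<close>
    define k where "k = nat \<lfloor>s * 2 ^ j\<rfloor>"
    have k: "real k \<le> s * 2 ^ j" "s * 2 ^ j < real (Suc k)"
      using s by (auto simp: k_def) linarith+
    have "t j k \<le> s + 1 / 2 ^ j" "s < t j k" using k by (auto simp: t_def field_simps)
    then have tv: "t j k < v" using j by linarith
    then have "real (Suc k) < v * 2 ^ j" by (simp add: t_def field_simps)
    also have "\<dots> \<le> real n * 2 ^ j" using v by (intro mult_right_mono) auto
    finally have "real (Suc k) < real (n * 2 ^ j)" by simp
    then have "k < n * 2 ^ j" by linarith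
    then have "t j k \<in> D" by (auto simp: D_def)
    then show "\<exists>r\<in>D. s < r \<and> r < u" using \<open>s < t j k\<close> tv v by (intro bexI[of _ "t j k"]) auto
  qed
  ultimately show ?thesis by (simp add: G_def t_def)
qed

end

section \<open>Comparison of boundaries\<close>

context levy_process
begin

lemma char_X:
  assumes "has_levy_triplet M X \<sigma>2 b \<nu>" "0 \<le> t"
  shows "char (distr M borel (X t)) u = exp (of_real t * levy_exponent \<sigma>2 b \<nu> u)"
proof -
  have "char (distr M borel (X t)) u = (CLINT \<omega>|M. iexp (u * X t \<omega>))"
    unfolding char_def by (rule integral_distr[OF random_variable_X[OF assms(2)]]) measurable
  then show ?thesis using assms by (simp add: has_levy_triplet_def)
qed

text \<open>Almost all paths start at 0 and are right-continuous there, so dominated convergence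
  applies. The limit removes the error of the coupling as the mesh shrinks.\<close>

lemma prob_X_le_tendsto_0:
  assumes h: "\<And>n. 0 < h n" "h \<longlonglongrightarrow> 0" and d: "0 < d"
  shows "(\<lambda>n. measure (distr M borel (X (h n))) {..- d}) \<longlonglongrightarrow> 0"
proof -
  have X: "X (h n) \<in> borel_measurable M" for n
    by (rule random_variable_X) (use h(1)[of n] in simp)
  have "(\<lambda>n. \<integral>\<omega>. indicat_real {..- d} (X (h n) \<omega>) \<partial>M) \<longlonglongrightarrow> (\<integral>\<omega>. 0 \<partial>M)"
  proof (rule integral_dominated_convergence[where w = "\<lambda>_. 1"])
    show "AE \<omega> in M. (\<lambda>n. indicat_real {..- d} (X (h n) \<omega>)) \<longlonglongrightarrow> 0"
      using start_zero cadlag_paths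
    proof eventually_elim
      case (elim \<omega>)
      have "((\<lambda>t. X t \<omega>) \<longlongrightarrow> 0) (at_right 0)" using elim by (auto simp: cadlag_def)
      moreover have "filterlim h (at_right 0) sequentially"
      proof -
        have "h n \<in> {0<..} \<and> h n \<noteq> 0" for n using h(1)[of n] by simp
        then show ?thesis using h(2) by (simp only: filterlim_at eventually_True simp_thms)
      qed
      ultimately have "(\<lambda>n. X (h n) \<omega>) \<longlonglongrightarrow> 0" by (rule filterlim_compose)
      then have "\<forall>\<^sub>F n in sequentially. - d < X (h n) \<omega>" by (rule order_tendstoD) (use d in auto)
      then have "\<forall>\<^sub>F n in sequentially. indicat_real {..- d} (X (h n) \<omega>) = 0"
        by eventually_elim auto
      then show ?case by (rule tendsto_eventually)
    qed
    show "(\<lambda>\<omega>. indicat_real {..- d} (X (h n) \<omega>)) \<in> borel_measurable M" for n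
      by (rule measurable_compose[OF X borel_measurable_indicator]) simp
  qed (auto simp: indicator_def)
  moreover have "measure (distr M borel (X (h n))) {..- d} = (\<integral>\<omega>. indicat_real {..- d} (X (h n) \<omega>) \<partial>M)" for n
  proof -
    interpret \<mu>: real_distribution "distr M borel (X (h n))"
      using h(1)[of n] by (intro real_distribution_X) simp
    have "measure (distr M borel (X (h n))) {..- d} = (\<integral>x. indicat_real {..- d} x \<partial>distr M borel (X (h n)))"
      by simp
    also have "\<dots> = (\<integral>\<omega>. indicat_real {..- d} (X (h n) \<omega>) \<partial>M)"
      by (rule integral_distr[OF X]) simp
    finally show ?thesis .
  qed
  ultimately show ?thesis by simp
qed

end

lemma prod_list_powr_le_exp_sum_list:
  fixes C :: "'b \<Rightarrow> real"
  assumes "\<And>x. x \<in> set l \<Longrightarrow> 0 \<le> C x \<and> C x \<le> 1 + q x" "0 \<le> s"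
  shows "prod_list (map (\<lambda>x. C x powr s) l) \<le> exp (s * sum_list (map q l))"
  using assms(1)
proof (induction l)
  case (Cons x l)
  have Cx: "0 \<le> C x" "C x \<le> 1 + q x" using Cons.prems[of x] by auto
  have "C x \<le> exp (q x)" using Cx exp_ge_add_one_self[of "q x"] by linarith
  then have "C x powr s \<le> exp (q x) powr s" using Cx assms(2) by (intro powr_mono2) auto
  also have "\<dots> = exp (s * q x)" by (simp add: powr_def mult.commute)
  finally have "C x powr s * prod_list (map (\<lambda>x. C x powr s) l) \<le> exp (s * q x) * exp (s * sum_list (map q l))"
    using Cons by (intro mult_mono prod_list_nonneg) auto
  then show ?case by (simp add: ring_distribs exp_add)
qed simp

context real_distribution
begin

text \<open>The first \<open>N\<close> steps, tilted at total intensity \<open>lam\<close>, lower the walk enough to make room for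
  the constant part of the boundary; the intensity of the later ones follows the increments of \<open>g\<close>.\<close>

lemma wstay_comparison:
  fixes g I :: "real \<Rightarrow> real" and N n p :: nat
  assumes N: "0 < N" and d: "0 < d" and p: "2 \<le> p"
    and D: "D \<ge> 0" "\<And>z. 0 \<le> z \<Longrightarrow> z \<le> 1 + R \<Longrightarrow> z ^ p \<le> 1 + real p * (z - 1) + D * (z - 1)\<^sup>2"
    and lam: "0 \<le> lam" "1 + g 0 \<le> d * (lam / 2 - 1)"
    and g: "0 \<le> g 0" "\<And>u v. 0 \<le> u \<Longrightarrow> u \<le> v \<Longrightarrow> g u \<le> g v"
      "\<And>u v. u \<le> v \<Longrightarrow> g v - g u \<le> F * (v - u)"
      "\<And>u v. u \<le> v \<Longrightarrow> (g v - g u)\<^sup>2 \<le> (v - u) * (I v - I u)"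
      "\<And>t. 0 \<le> I t" "\<And>t. I t \<le> C"
    and A: "lam / N \<le> A / N" "2 / d * F / N \<le> A / N" "A / N \<le> 1" "A / N \<le> R * prob {..- 2 * d}"
    and m: "0 < c" "c / N \<le> prob {..- 2 * d}"
  shows "wstay M (map (\<lambda>k. (\<lambda>_. 1, 1)) [0..<N]) 0 *
         wstay M (map (\<lambda>k. (\<lambda>_. 1, 1 + g (real (Suc k) * (1 / N)))) [0..<n * N]) 0 * (1 - exp (- 1))
    \<le> exp (1 / p * (D * (lam\<^sup>2 + (2 / d)\<^sup>2 * C) / c)) *
        wstay M (map (\<lambda>k. (\<lambda>_. 1, 1)) [0..<Suc n * N]) 0 powr (1 - 1 / p)
      + (lam + 2 / d * (g n - g 0)) * prob {..- d}"
proof -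
  define h where "h = 1 / real N"
  \<comment> \<open>The factor \<open>2 / d\<close> makes \<open>d * (L / 2) = 1\<close>: it undoes
    the jump height \<open>d\<close> and the one half in the maximal inequality for
    \<open>jumps\<close>.\<close>
  define L where "L = 2 / d"
  have h: "0 < h" "real N * h = 1" using N by (auto simp: h_def)
  have L: "0 < L" using d by (simp add: L_def)
  have m0: "0 < prob {..- 2 * d}" using m N by (auto intro: less_le_trans[rotated])
  define \<kappa> where "\<kappa> i = (if i < N then lam * h else L * (g (real (Suc (i - N)) * h) - g (real (i - N) * h)))" for i
  \<comment> \<open>After the first \<open>N\<close> steps the walk may be anywhere up to 1, so the
    boundary \<open>1 + g\<close> is run from level 1 and becomes \<open>2 + g\<close>.\<close>
  define b where "b i = (if i < N then 1 else 2 + g (real (Suc (i - N)) * h))" for i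
  define K where "K = N + n * N"
  define l where "l = map (\<lambda>i. (\<kappa> i, b i)) [0..<K]"
  have split: "[0..<K] = [0..<N] @ map (\<lambda>k. N + k) [0..<n * N]"
    using upt_add_eq_append[of 0 N "n * N"] map_add_upt[of N "n * N"]
    by (simp only: K_def add.commute[of _ N] le0)
  have step: "0 \<le> real k * h" "real k * h \<le> real (Suc k) * h" "real (Suc k) * h - real k * h = h" for k
    using h by (auto simp: algebra_simps)
  have \<kappa>_lt: "\<kappa> i = lam * h" if "i < N" for i using that by (simp add: \<kappa>_def)
  have \<kappa>_add: "\<kappa> (N + q) = L * (g (real (Suc q) * h) - g (real q * h))" for q by (simp add: \<kappa>_def)
  have "0 \<le> \<kappa> i \<and> \<kappa> i \<le> A / N" for i
  proof (cases "i < N")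
    case True
    then show ?thesis using lam h A(1) by (simp add: \<kappa>_lt) (simp add: h_def)
  next
    case False
    then obtain q where i: "i = N + q" by (metis le_add_diff_inverse not_less)
    define \<Delta> where "\<Delta> = g (real (Suc q) * h) - g (real q * h)"
    have \<Delta>: "0 \<le> \<Delta>" using g(2)[OF step(1,2)] by (simp only: \<Delta>_def diff_ge_0_iff_ge)
    have "\<Delta> \<le> F * h" using g(3)[OF step(2)[of q]] by (simp only: \<Delta>_def step(3))
    then have "L * \<Delta> \<le> L * (F * h)" using L by (intro mult_left_mono) auto
    also have "L * (F * h) \<le> A / N" using A(2) by (simp add: L_def h_def)
    finally show ?thesis unfolding i \<kappa>_add \<Delta>_def[symmetric] using L \<Delta> by simp
  qed
  then have \<kappa>: "0 \<le> \<kappa> i" "\<kappa> i \<le> A / N" for i by blast+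
  have \<kappa>1: "\<kappa> i \<le> 1" and \<kappa>R: "\<kappa> i \<le> R * prob {..- 2 * d}" for i
    using \<kappa>(2)[of i] A(3,4) by linarith+
  have l\<kappa>: "\<forall>\<kappa>b\<in>set l. 0 \<le> fst \<kappa>b \<and> fst \<kappa>b \<le> 1"
    unfolding l_def using \<kappa>(1) \<kappa>1 by auto
  have sum\<kappa>: "(\<Sum>j<N + q. \<kappa> j) = lam + L * (g (real q * h) - g 0)" for q
  proof (induction q)
    case 0
    have "(\<Sum>j<N. \<kappa> j) = (\<Sum>j<N. lam * h)" by (rule sum.cong) (auto simp: \<kappa>_lt)
    then show ?case using h by (simp add: mult.left_commute)
  next
    case (Suc q)
    have "(\<Sum>j<N + Suc q. \<kappa> j) = (\<Sum>j<N + q. \<kappa> j) + \<kappa> (N + q)" by simp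
    then show ?case unfolding Suc \<kappa>_add by (simp add: algebra_simps)
  qed
  \<comment> \<open>The hypothesis on squared increments makes the sum telescope and leaves a factor
    \<open>h\<close>, to be set against \<open>prob {..- 2 * d} \<ge> c * h\<close>.\<close>
  have sum\<kappa>2: "(\<Sum>j<N + q. (\<kappa> j)\<^sup>2) \<le> h * (lam\<^sup>2 + L\<^sup>2 * (I (real q * h) - I 0))" for q
  proof (induction q)
    case 0
    have "(\<Sum>j<N. (\<kappa> j)\<^sup>2) = (\<Sum>j<N. (lam * h)\<^sup>2)" by (rule sum.cong) (auto simp: \<kappa>_lt)
    also have "\<dots> = (real N * h) * (h * lam\<^sup>2)" by (simp add: power2_eq_square)
    finally show ?case by (simp add: h)
  next
    case (Suc q)
    have "(\<kappa> (N + q))\<^sup>2 = L\<^sup>2 * (g (real (Suc q) * h) - g (real q * h))\<^sup>2"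
      unfolding \<kappa>_add by (rule power_mult_distrib)
    also have "\<dots> \<le> L\<^sup>2 * (h * (I (real (Suc q) * h) - I (real q * h)))"
      using g(4)[OF step(2)[of q]] by (intro mult_left_mono) (simp_all only: step(3) zero_le_power2)
    finally have "(\<kappa> (N + q))\<^sup>2 \<le> L\<^sup>2 * (h * (I (real (Suc q) * h) - I (real q * h)))" .
    moreover have "(\<Sum>j<N + Suc q. (\<kappa> j)\<^sup>2) = (\<Sum>j<N + q. (\<kappa> j)\<^sup>2) + (\<kappa> (N + q))\<^sup>2" by simp
    ultimately have "(\<Sum>j<N + Suc q. (\<kappa> j)\<^sup>2) \<le> h * (lam\<^sup>2 + L\<^sup>2 * (I (real q * h) - I 0)) +
        L\<^sup>2 * (h * (I (real (Suc q) * h) - I (real q * h)))"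
      using Suc by linarith
    also have "\<dots> = h * (lam\<^sup>2 + L\<^sup>2 * (I (real (Suc q) * h) - I 0))"
      by (simp only: ring_distribs) (simp add: mult_ac)
    finally show ?case .
  qed
  \<comment> \<open>The maximal inequality is used with margin 1. During the first \<open>N\<close>
    steps the threshold is 0; afterwards \<open>lam\<close> pays for the margin and for
    \<open>1 + g 0\<close>, and the later intensities pay for the growth of
    \<open>g\<close>.\<close>
  have jumps: "1 - exp (- 1) \<le> jumps d l 0"
  proof (rule jumps_lower_bound[OF l\<kappa>])
    show "0 \<le> d" using d by simp
    fix i assume "i < length l"
    then have i: "i < K" by (simp add: l_def)
    have nth: "l ! j = (\<kappa> j, b j)" if "j \<le> i" for j using that i by (simp add: l_def)
    have sum_nth: "(\<Sum>j\<le>i. fst (l ! j)) = (\<Sum>j<Suc i. \<kappa> j)"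
      unfolding lessThan_Suc_atMost by (rule sum.cong) (auto simp: nth)
    show "snd (l ! i) - 1 \<le> 0 \<or> snd (l ! i) - 1 \<le> 0 + d * ((\<Sum>j\<le>i. fst (l ! j)) / 2 - 1)"
    proof (cases "i < N")
      case True
      then show ?thesis by (simp add: nth b_def)
    next
      case False
      define q where "q = i - N"
      have i_eq: "i = N + q" using False by (simp add: q_def)
      have "(\<Sum>j\<le>i. fst (l ! j)) = lam + L * (g (real (Suc q) * h) - g 0)"
        unfolding sum_nth using sum\<kappa>[of "Suc q"] by (simp add: i_eq)
      moreover have "snd (l ! i) - 1 = 1 + g (real (Suc q) * h)"
        using False by (simp add: nth b_def q_def)
      moreover have "1 + g (real (Suc q) * h) \<le> d * ((lam + L * (g (real (Suc q) * h) - g 0)) / 2 - 1)"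
      proof -
        have "d * ((lam + L * (g (real (Suc q) * h) - g 0)) / 2 - 1) = d * (lam / 2 - 1) + (g (real (Suc q) * h) - g 0)"
          using d by (simp add: L_def field_simps)
        then show ?thesis using lam(2) by linarith
      qed
      ultimately show ?thesis by simp
    qed
  qed
  have b_map: "map (\<lambda>(\<kappa>, b). (\<lambda>_::real. 1::real, b)) l =
      map (\<lambda>k. (\<lambda>_. 1, 1)) [0..<N] @ map (\<lambda>k. (\<lambda>_. 1, 2 + g (real (Suc k) * h))) [0..<n * N]"
    unfolding l_def split by (simp add: b_def comp_def)
  have one: "\<forall>zb\<in>set (map (\<lambda>k. (\<lambda>_::real. 1::real, B k)) ks). weight M (fst zb)"
    for B :: "nat \<Rightarrow> real" and ks using weight_one by auto
  \<comment> \<open>Two stages: the walk stays below 1 during the first \<open>N\<close> steps, then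
    follows the raised boundary from level 1; translation by 1 turns the second stage into a walk
    from 0.\<close>
  have stay: "wstay M (map (\<lambda>k. (\<lambda>_. 1, 1)) [0..<N]) 0 *
         wstay M (map (\<lambda>k. (\<lambda>_. 1, 1 + g (real (Suc k) * h))) [0..<n * N]) 0
     \<le> wstay M (map (\<lambda>(\<kappa>, b). (\<lambda>_. 1, b)) l) 0"
  proof -
    have "wstay M (map (\<lambda>k. (\<lambda>_. 1, 1)) [0..<N]) 0 * wstay M (map (\<lambda>k. (\<lambda>_. 1, 2 + g (real (Suc k) * h))) [0..<n * N]) 1
       \<le> wstay M (map (\<lambda>(\<kappa>, b). (\<lambda>_. 1, b)) l) 0"
      unfolding b_map
    proof (rule wstay_append_ge)
      show "\<forall>zb\<in>set (map (\<lambda>k. (\<lambda>_. 1, 1)) [0..<N] @ map (\<lambda>k. (\<lambda>_. 1, 2 + g (real (Suc k) * h))) [0..<n * N]).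
          weight M (fst zb)"
        using weight_one by auto
    qed (use N in \<open>auto simp: last_map\<close>)
    moreover have "wstay M (map (\<lambda>k. (\<lambda>_. 1, 2 + g (real (Suc k) * h))) [0..<n * N]) 1 =
       wstay M (map (\<lambda>k. (\<lambda>_. 1, 1 + g (real (Suc k) * h))) [0..<n * N]) 0"
      using wstay_shift[of 1 "map (\<lambda>k. (\<lambda>_. 1, 1 + g (real (Suc k) * h))) [0..<n * N]" 0]
      by (simp add: comp_def add_ac)
    ultimately show ?thesis by simp
  qed
  define l2 where "l2 = map (\<lambda>i. (tilt d (\<kappa> i), 1::real)) [0..<K]"
  have l2_eq: "map (\<lambda>(\<kappa>, b). (tilt d \<kappa>, 1)) l = l2" by (simp add: l2_def l_def comp_def)
  have l2_one: "map (\<lambda>(z, b). (\<lambda>_::real. 1::real, b)) l2 = map (\<lambda>k. (\<lambda>_. 1, 1)) [0..<Suc n * N]"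
    by (simp add: l2_def comp_def K_def)
  have sum_l: "sum_list (map fst l) = lam + L * (g n - g 0)"
  proof -
    have "sum_list (map fst l) = (\<Sum>j<K. \<kappa> j)"
      by (simp add: l_def comp_def interv_sum_list_conv_sum_set_nat atLeast0LessThan)
    moreover have "real (n * N) * h = real n" using h by simp
    ultimately show ?thesis unfolding K_def by (simp only: sum\<kappa>)
  qed
  \<comment> \<open>The maximum with 1 secures the positivity that Hoelder's inequality demands; as
    \<open>q i \<ge> 0\<close>, the upper bound \<open>1 + q i\<close> survives.\<close>
  define Cz where "Cz z = max 1 (\<integral>y. z y ^ p \<partial>M)" for z :: "real \<Rightarrow> real"
  define q where "q i = D * (\<kappa> i)\<^sup>2 / prob {..- 2 * d}" for i
  have q0: "0 \<le> q i" for i using D(1) by (simp add: q_def)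
  have Cq: "0 \<le> Cz (tilt d (\<kappa> i)) \<and> Cz (tilt d (\<kappa> i)) \<le> 1 + q i" for i
    using tilt_moment[OF D \<kappa>(1)[of i] \<kappa>1 m0 \<kappa>R] q0[of i] by (simp add: Cz_def q_def)
  have holder: "wstay M l2 0 \<le> prod_list (map (\<lambda>(z, b). Cz z powr (1 / real p)) l2) *
     wstay M (map (\<lambda>k. (\<lambda>_. 1, 1)) [0..<Suc n * N]) 0 powr (1 - 1 / real p)"
    unfolding l2_one[symmetric]
  proof (rule wstay_holder[OF p])
    show "\<forall>zb\<in>set l2. weight M (fst zb)"
      using weight_tilt[OF \<kappa>(1) \<kappa>1 m0] by (auto simp: l2_def)
    show "\<forall>zb\<in>set l2. 0 < Cz (fst zb) \<and> (\<integral>y. fst zb y ^ p \<partial>M) \<le> Cz (fst zb)"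
      by (auto simp: Cz_def less_max_iff_disj)
  qed
  have "sum_list (map q [0..<K]) = D / prob {..- 2 * d} * (\<Sum>j<N + n * N. (\<kappa> j)\<^sup>2)"
    unfolding q_def K_def
    by (simp add: interv_sum_list_conv_sum_set_nat atLeast0LessThan sum_distrib_left)
  \<comment> \<open>The mesh cancels here, which makes the constant independent of \<open>N\<close>
    and \<open>n\<close>.\<close>
  also have "\<dots> \<le> D / (c * h) * (h * (lam\<^sup>2 + L\<^sup>2 * C))"
  proof (rule mult_mono)
    show "D / prob {..- 2 * d} \<le> D / (c * h)"
      by (rule divide_left_mono[OF _ D(1) mult_pos_pos[OF m0 mult_pos_pos[OF m(1) h(1)]]])
         (use m(2) in \<open>simp add: h_def\<close>)
    have "(\<Sum>j<N + n * N. (\<kappa> j)\<^sup>2) \<le> h * (lam\<^sup>2 + L\<^sup>2 * (I (real (n * N) * h) - I 0))" by (rule sum\<kappa>2)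
    also have "\<dots> \<le> h * (lam\<^sup>2 + L\<^sup>2 * C)"
      using h g(5)[of 0] g(6)[of "real (n * N) * h"] by (intro mult_left_mono add_left_mono) auto
    finally show "(\<Sum>j<N + n * N. (\<kappa> j)\<^sup>2) \<le> h * (lam\<^sup>2 + L\<^sup>2 * C)" .
  qed (use D(1) m h in \<open>auto intro!: sum_nonneg divide_nonneg_nonneg\<close>)
  also have "\<dots> = D * (lam\<^sup>2 + L\<^sup>2 * C) / c" using h m by simp
  finally have sumq: "sum_list (map q [0..<K]) \<le> D * (lam\<^sup>2 + L\<^sup>2 * C) / c" .
  have "prod_list (map (\<lambda>(z, b). Cz z powr (1 / real p)) l2) = prod_list (map (\<lambda>i. Cz (tilt d (\<kappa> i)) powr (1 / real p)) [0..<K])"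
    by (simp add: l2_def comp_def)
  also have "\<dots> \<le> exp (1 / real p * sum_list (map q [0..<K]))"
    by (rule prod_list_powr_le_exp_sum_list) (use Cq in auto)
  also have "\<dots> \<le> exp (1 / real p * (D * (lam\<^sup>2 + L\<^sup>2 * C) / c))"
    using mult_left_mono[OF sumq, of "1 / real p"] by simp
  finally have prod: "prod_list (map (\<lambda>(z, b). Cz z powr (1 / real p)) l2) \<le> exp (1 / real p * (D * (lam\<^sup>2 + L\<^sup>2 * C) / c))" .
  have "0 \<le> wstay M (map (\<lambda>(\<kappa>, b). (\<lambda>_. 1, b)) l) 0"
    using wstay_props[OF one[of b "[0..<K]"]] by (simp add: l_def comp_def)
  then have "wstay M (map (\<lambda>k. (\<lambda>_. 1, 1)) [0..<N]) 0 *
         wstay M (map (\<lambda>k. (\<lambda>_. 1, 1 + g (real (Suc k) * h))) [0..<n * N]) 0 * (1 - exp (- 1))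
    \<le> wstay M (map (\<lambda>(\<kappa>, b). (\<lambda>_. 1, b)) l) 0 * jumps d l 0"
    by (intro mult_mono stay jumps) auto
  also have "\<dots> \<le> wstay M l2 0 + (lam + L * (g n - g 0)) * prob {..- d}"
    using wstay_coupling[OF l\<kappa> d m0, of 0 0] by (simp only: l2_eq sum_l diff_self)
  also have "wstay M l2 0 \<le> exp (1 / real p * (D * (lam\<^sup>2 + L\<^sup>2 * C) / c)) *
     wstay M (map (\<lambda>k. (\<lambda>_. 1, 1)) [0..<Suc n * N]) 0 powr (1 - 1 / real p)"
    by (rule order_trans[OF holder mult_right_mono[OF prod]]) simp
  finally show ?thesis by (simp add: h_def L_def)
qed

end

context levy_process
begin

text \<open>The grid inequality is applied with mesh \<open>1 / 2 ^ j\<close> and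
  \<open>j \<rightarrow> \<infinity>\<close> for fixed \<open>n\<close>: the coupling error vanishes
  and the grid probabilities for level 1 converge. The positive probability for unit time absorbs
  the preliminary steps, and \<open>K\<close> depends neither on \<open>n\<close> nor on
  \<open>T\<close>.\<close>

lemma prob_below_comparison:
  fixes g I :: "real \<Rightarrow> real" and p :: nat
  assumes X: "has_levy_triplet M X \<sigma>2 b \<nu>" "emeasure \<nu> {..<0} > 0"
    and pos: "prob_below M X (\<lambda>_. 1) 1 > 0" and p: "2 \<le> p"
    and g: "0 \<le> g 0" "\<And>u v. 0 \<le> u \<Longrightarrow> u \<le> v \<Longrightarrow> g u \<le> g v"
      "\<And>u v. u \<le> v \<Longrightarrow> g v - g u \<le> F * (v - u)"
      "\<And>u v. u \<le> v \<Longrightarrow> (g v - g u)\<^sup>2 \<le> (v - u) * (I v - I u)"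
      "\<And>t. 0 \<le> I t" "\<And>t. I t \<le> C"
    and f: "\<And>t. 0 \<le> t \<Longrightarrow> f t \<le> g t"
  shows "\<exists>K>0. \<forall>n T. 0 < n \<longrightarrow> real n \<le> T \<longrightarrow>
    prob_below M X (\<lambda>t. 1 + f t) T \<le> K * prob_below M X (\<lambda>_. 1) (real (Suc n)) powr (1 - 1 / real p)"
proof -
  define h :: "nat \<Rightarrow> real" where "h j = 1 / 2 ^ j" for j
  define \<mu> where "\<mu> j = distr M borel (X (h j))" for j
  have h: "0 < h j" for j by (simp add: h_def)
  have h0: "h \<longlonglongrightarrow> 0" unfolding h_def by (rule LIMSEQ_divide_realpow_zero) simp
  have \<mu>: "real_distribution (\<mu> j)" for j
    unfolding \<mu>_def by (rule real_distribution_X) (use h[of j] in simp)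
  have char: "char (\<mu> j) u = exp (of_real (h j) * levy_exponent \<sigma>2 b \<nu> u)" for j u
    unfolding \<mu>_def by (rule char_X[OF X(1)]) (use h[of j] in simp)
  have \<nu>: "levy_measure \<nu>" using X(1) by (simp add: has_levy_triplet_def)
  obtain d c where d: "0 < d" and c: "0 < c"
    and m: "\<forall>\<^sub>F j in sequentially. c * h j \<le> measure (\<mu> j) {..- 2 * d}"
    using levy_small_time_lower_bound[OF \<mu> h h0 char \<nu> X(2)] by blast
  \<comment> \<open>The solution of \<open>d * (lam / 2 - 1) = 1 + g 0\<close>.\<close>
  define lam where "lam = 2 * ((1 + g 0) / d + 1)"
  have lam: "0 \<le> lam" "1 + g 0 \<le> d * (lam / 2 - 1)"
    using g(1) d by (simp_all add: lam_def field_simps)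
  \<comment> \<open>\<open>A * h j\<close> will bound every jump probability; with
    \<open>R = A / c\<close> it equals \<open>R * (c * h j)\<close>, hence for small mesh is at most
    \<open>R\<close> times the mass of the tail.\<close>
  define A where "A = max lam (2 / d * F)"
  define R where "R = A / c"
  have R0: "0 \<le> R" using c lam by (simp add: R_def A_def)
  obtain D where D: "0 \<le> D"
    "\<And>z. 0 \<le> z \<Longrightarrow> z \<le> 1 + R \<Longrightarrow> z ^ p \<le> 1 + real p * (z - 1) + D * (z - 1)\<^sup>2"
    using power_le_second_order[of "1 + R" p] R0 by auto
  define E where "E = exp (1 / p * (D * (lam\<^sup>2 + (2 / d)\<^sup>2 * C) / c))"
  define c0 where "c0 = prob_below M X (\<lambda>_. 1) 1 * (1 - exp (- 1))"
  have c0: "0 < c0" using pos by (simp add: c0_def)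
  have cont: "continuous_on {0..} (\<lambda>_::real. 1::real)" by simp
  have main: "c0 * prob_below M X (\<lambda>t. 1 + f t) T \<le> E * prob_below M X (\<lambda>_. 1) (real (Suc n)) powr (1 - 1 / real p)"
    if n: "0 < n" and T: "real n \<le> T" for n T
  proof -
    define G where "G k j = prob {\<omega> \<in> space M. \<forall>i<k * 2 ^ j. X (real (Suc i) * (1 / 2 ^ j)) \<omega> \<le> 1}" for k j :: nat
    \<comment> \<open>The total jump intensity over the \<open>n + 1\<close> time units. It does not
      depend on \<open>j\<close>, so its product with the vanishing tail mass disappears in the
      limit.\<close>
    define S where "S = lam + 2 / d * (g n - g 0)"
    have lim: "(\<lambda>j. E * G (Suc n) j powr (1 - 1 / real p) + S * measure (\<mu> j) {..- d})
        \<longlonglongrightarrow> E * prob_below M X (\<lambda>_. 1) (real (Suc n)) powr (1 - 1 / real p) + S * 0"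
    proof (intro tendsto_add tendsto_mult tendsto_const)
      have "(\<lambda>j. G (Suc n) j) \<longlonglongrightarrow> prob_below M X (\<lambda>_. 1) (real (Suc n))"
        unfolding G_def by (rule grid_limit[OF cont]) simp
      then show "(\<lambda>j. G (Suc n) j powr (1 - 1 / real p)) \<longlonglongrightarrow> prob_below M X (\<lambda>_. 1) (real (Suc n)) powr (1 - 1 / real p)"
        by (rule tendsto_powr'[OF _ tendsto_const]) (use p in \<open>auto simp: G_def\<close>)
      show "(\<lambda>j. measure (\<mu> j) {..- d}) \<longlonglongrightarrow> 0"
        unfolding \<mu>_def by (rule prob_X_le_tendsto_0[OF h h0 d])
    qed
    have "(\<lambda>j. A * h j) \<longlonglongrightarrow> A * 0" by (intro tendsto_mult tendsto_const h0)
    then have "\<forall>\<^sub>F j in sequentially. A * h j < 1" by (rule order_tendstoD) simp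
    then have ev: "\<forall>\<^sub>F j in sequentially. c0 * prob_below M X (\<lambda>t. 1 + f t) T
        \<le> E * G (Suc n) j powr (1 - 1 / real p) + S * measure (\<mu> j) {..- d}"
      using m
    proof eventually_elim
      case (elim j)
      interpret \<mu>: real_distribution "\<mu> j" by (rule \<mu>)
      have hN: "1 / real (2 ^ j) = h j" "h j = 1 / 2 ^ j" by (simp_all add: h_def)
      have N: "A / real (2 ^ j) = A * h j" for A by (simp add: h_def)
      have "A * h j = R * (c * h j)" using c by (simp add: R_def)
      also have "\<dots> \<le> R * measure (\<mu> j) {..- 2 * d}" using elim R0 by (intro mult_left_mono)
      finally have AR: "A * h j \<le> R * measure (\<mu> j) {..- 2 * d}" .
      have le: "lam * h j \<le> A * h j" "2 / d * F * h j \<le> A * h j"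
        using h[of j] by (intro mult_right_mono; simp add: A_def)+
      define W1 where "W1 = wstay (\<mu> j) (map (\<lambda>k. (\<lambda>_. 1, 1)) [0..<2 ^ j]) 0"
      define W2 where "W2 = wstay (\<mu> j) (map (\<lambda>k. (\<lambda>_. 1, 1 + g (real (Suc k) * h j))) [0..<n * 2 ^ j]) 0"
      define W3 where "W3 = wstay (\<mu> j) (map (\<lambda>k. (\<lambda>_. 1, 1)) [0..<Suc n * 2 ^ j]) 0"
      have cmp: "W1 * W2 * (1 - exp (- 1)) \<le> E * W3 powr (1 - 1 / real p) + S * measure (\<mu> j) {..- d}"
        using \<mu>.wstay_comparison[where N = "2 ^ j" and g = g and I = I and n = n and p = p and A = A and R = R
            and lam = lam, OF _ d p D lam g, unfolded N hN(1)] le AR elim c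
        by (simp add: W1_def W2_def W3_def E_def S_def)
      have grid: "prob {\<omega> \<in> space M. \<forall>k<i. X (real (Suc k) * h j) \<omega> \<le> B k}
          = wstay (\<mu> j) (map (\<lambda>k. (\<lambda>_. 1, B k)) [0..<i]) 0" if "0 < i" for i B
        unfolding \<mu>_def by (rule prob_grid[OF h that])
      have hn: "real (k * 2 ^ j) * h j = real k" for k by (simp add: h_def)
      have W1: "prob_below M X (\<lambda>_. 1) 1 \<le> W1"
        unfolding W1_def grid[symmetric, of "2 ^ j" "\<lambda>_. 1", simplified]
        using prob_below_le_grid[OF h, of "2 ^ j" j 1 "\<lambda>_. 1" "\<lambda>_. 1"] hn[of 1] by simp
      have W2: "prob_below M X (\<lambda>t. 1 + f t) T \<le> W2"
      proof -
        have "prob_below M X (\<lambda>t. 1 + f t) T \<le>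
           prob {\<omega> \<in> space M. \<forall>k<n * 2 ^ j. X (real (Suc k) * h j) \<omega> \<le> 1 + g (real (Suc k) * h j)}"
        proof (rule prob_below_le_grid[OF h])
          show "real (n * 2 ^ j) * h j \<le> T" using T by (simp only: hn)
          show "1 + f (real (Suc k) * h j) \<le> 1 + g (real (Suc k) * h j)" for k
            using h[of j] by (intro add_left_mono f mult_nonneg_nonneg) auto
        qed
        also have "\<dots> = W2" unfolding W2_def by (rule grid) (use n in simp)
        finally show ?thesis .
      qed
      have W3: "G (Suc n) j = W3"
        unfolding G_def W3_def hN(2)[symmetric] by (rule grid) simp
      have "c0 * prob_below M X (\<lambda>t. 1 + f t) T \<le> W1 * W2 * (1 - exp (- 1))"
      proof -
        have "prob_below M X (\<lambda>_. 1) 1 * prob_below M X (\<lambda>t. 1 + f t) T \<le> W1 * W2"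
          by (rule mult_mono[OF W1 W2]) (use pos W1 in \<open>auto simp: prob_below_def\<close>)
        then have "prob_below M X (\<lambda>_. 1) 1 * prob_below M X (\<lambda>t. 1 + f t) T * (1 - exp (- 1)) \<le> W1 * W2 * (1 - exp (- 1))"
          by (rule mult_right_mono) simp
        then show ?thesis by (simp add: c0_def mult_ac)
      qed
      then show ?case using cmp unfolding W3 by (rule order_trans)
    qed
    from tendsto_lowerbound[OF lim ev] show ?thesis by simp
  qed
  show ?thesis
  proof (intro exI[of _ "E / c0"] conjI allI impI)
    show "0 < E / c0" using c0 by (simp add: E_def)
    fix n T assume "0 < n" "real n \<le> T"
    from main[OF this] show "prob_below M X (\<lambda>t. 1 + f t) T \<le> E / c0 * prob_below M X (\<lambda>_. 1) (real (Suc n)) powr (1 - 1 / real p)"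
      using c0 by (simp add: field_simps)
  qed
qed

end

section \<open>Decay exponents and the slope of the boundary\<close>

text \<open>After division by \<open>ln T\<close> the constant \<open>K\<close> disappears, so the
  limit points of \<open>ln (Q T) / ln T\<close> lie between \<open>- \<delta>\<close> and
  \<open>- (1 - 1 / p) * \<delta>\<close> for each \<open>p\<close>, and \<open>p\<close> is
  arbitrary.\<close>

lemma has_decay_exponent_compare:
  fixes P Q :: "real \<Rightarrow> real"
  assumes P: "has_decay_exponent P \<delta>"
    and PQ: "\<And>T. 1 \<le> T \<Longrightarrow> P T \<le> Q T"
    and QP: "\<And>p::nat. 2 \<le> p \<Longrightarrow> \<exists>K>0. \<forall>T\<ge>1. Q T \<le> K * P T powr (1 - 1 / real p)"
  shows "has_decay_exponent Q \<delta>"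
proof -
  have P0: "\<forall>\<^sub>F T in at_top. 0 < P T" and Plim: "((\<lambda>T. ln (P T) / ln T) \<longlongrightarrow> - \<delta>) at_top"
    using P by (auto simp: has_decay_exponent_def)
  have ev: "\<forall>\<^sub>F T in at_top. 1 < (T::real)" by (rule eventually_gt_at_top)
  have Q0: "\<forall>\<^sub>F T in at_top. 0 < Q T"
    using P0 ev by eventually_elim (use PQ in \<open>force intro: less_le_trans\<close>)
  moreover have "((\<lambda>T. ln (Q T) / ln T) \<longlongrightarrow> - \<delta>) at_top"
  proof (rule order_tendstoI)
    fix a assume "a < - \<delta>"
    from order_tendstoD(1)[OF Plim this] P0 ev show "\<forall>\<^sub>F T in at_top. a < ln (Q T) / ln T"
    proof eventually_elim
      case (elim T)
      have "ln (P T) / ln T \<le> ln (Q T) / ln T"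
        using elim PQ[of T] by (intro divide_right_mono) auto
      then show ?case using elim by linarith
    qed
  next
    fix a assume a: "- \<delta> < a"
    \<comment> \<open>Chosen so large that \<open>\<delta> / p < a + \<delta>\<close>, that is,
      \<open>- (1 - 1 / p) * \<delta> < a\<close>.\<close>
    obtain p0 :: nat where p0: "\<delta> / (a + \<delta>) < p0" using reals_Archimedean2 by blast
    define p where "p = max 2 p0"
    have p: "2 \<le> p" "\<delta> / (a + \<delta>) < p" using p0 by (auto simp: p_def)
    then have "\<delta> < p * (a + \<delta>)" using a by (simp add: pos_divide_less_eq)
    then have "\<delta> / p < a + \<delta>" using p by (simp add: pos_divide_less_eq mult.commute)
    then have lt: "0 + (1 - 1 / p) * - \<delta> < a" by (simp add: algebra_simps)
    obtain K where K: "K > 0" "\<And>T. 1 \<le> T \<Longrightarrow> Q T \<le> K * P T powr (1 - 1 / p)"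
      using QP[OF p(1)] by blast
    have "((\<lambda>T. ln K / ln T + (1 - 1 / p) * (ln (P T) / ln T)) \<longlongrightarrow> 0 + (1 - 1 / p) * - \<delta>) at_top"
      by (intro tendsto_add tendsto_mult tendsto_const Plim tendsto_divide_0[OF tendsto_const]
          filterlim_mono[OF ln_at_top at_top_le_at_infinity order_refl])
    from order_tendstoD(2)[OF this lt] P0 Q0 ev show "\<forall>\<^sub>F T in at_top. ln (Q T) / ln T < a"
    proof eventually_elim
      case (elim T)
      have "ln (Q T) \<le> ln (K * P T powr (1 - 1 / real p))"
        using elim K(2)[of T] by (subst ln_le_cancel_iff) auto
      also have "\<dots> = ln K + (1 - 1 / p) * ln (P T)"
        using elim K(1) by (simp add: ln_mult ln_powr)
      finally have "ln (Q T) / ln T \<le> (ln K + (1 - 1 / p) * ln (P T)) / ln T"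
        using elim by (intro divide_right_mono) auto
      then show ?case using elim by (simp add: add_divide_distrib)
    qed
  qed
  ultimately show ?thesis by (simp add: has_decay_exponent_def)
qed

text \<open>Freezing the function before time 1 extends bounds for \<open>deriv f\<close> on
  \<open>{1..}\<close> to all times. \<open>I\<close> is the energy
  \<open>\<integral> f'\<^sup>2\<close> accumulated since time 1, and the last estimate is the
  Cauchy-Schwarz inequality.\<close>

lemma square_integrable_derivative_bounds:
  fixes f :: "real \<Rightarrow> real"
  assumes f: "f differentiable_on {0..}" "set_integrable lborel {1..} (\<lambda>s. (deriv f s)\<^sup>2)"
    "bdd_above ((\<lambda>s. \<bar>deriv f s\<bar>) ` {1..})"
  obtains I :: "real \<Rightarrow> real" and C F :: real where
    "\<And>t. 0 \<le> I t" "\<And>t. I t \<le> C" "0 \<le> F"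
    "\<And>u v. u \<le> v \<Longrightarrow> f (max 1 v) - f (max 1 u) \<le> F * (v - u)"
    "\<And>u v. u \<le> v \<Longrightarrow> (f (max 1 v) - f (max 1 u))\<^sup>2 \<le> (v - u) * (I v - I u)"
proof -
  obtain F where F: "\<And>s. 1 \<le> s \<Longrightarrow> \<bar>deriv f s\<bar> \<le> F" using f(3) by (auto simp: bdd_above_def)
  define J where "J u v = integral {u..v} (\<lambda>s. (deriv f s)\<^sup>2)" for u v
  define I where "I t = J 1 (max 1 t)" for t
  have der: "(f has_real_derivative deriv f s) (at s)" if "1 \<le> s" for s
  proof -
    have "f differentiable (at s within {0..})" using f(1) that by (auto simp: differentiable_on_def)
    moreover have "at s within {0..} = at s" using that by (intro at_within_interior) simp
    ultimately have "f differentiable (at s)" by (simp only:)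
    then show ?thesis by (simp add: DERIV_deriv_iff_real_differentiable)
  qed
  have int: "(deriv f has_integral f v - f u) {u..v}" if "1 \<le> u" "u \<le> v" for u v
    by (rule fundamental_theorem_of_calculus)
       (use that der in \<open>auto simp flip: has_real_derivative_iff_has_vector_derivative intro: has_field_derivative_at_within\<close>)
  have sq: "(\<lambda>s. (deriv f s)\<^sup>2) integrable_on {u..v}" if "1 \<le> u" for u v
  proof -
    have "set_integrable lborel {u..v} (\<lambda>s. (deriv f s)\<^sup>2)"
      by (rule set_integrable_subset[OF f(2)]) (use that in auto)
    then show ?thesis by (rule set_borel_integral_eq_integral)
  qed
  have sq1: "(\<lambda>s. (deriv f s)\<^sup>2) integrable_on {1..}"
    using f(2) by (rule set_borel_integral_eq_integral)
  have CS: "(f v - f u)\<^sup>2 \<le> (v - u) * J u v" if uv: "1 \<le> u" "u \<le> v" for u v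
  proof (cases "u = v")
    case False
    then have uv': "u < v" using uv by simp
    \<comment> \<open>\<open>c\<close> is the mean slope; Cauchy-Schwarz amounts to the integral of
      \<open>(deriv f s - c)\<^sup>2\<close> being nonnegative.\<close>
    define c where "c = (f v - f u) / (v - u)"
    have "((\<lambda>s. (deriv f s)\<^sup>2 - 2 * c * deriv f s + c\<^sup>2) has_integral
        J u v - 2 * c * (f v - f u) + (v - u) * c\<^sup>2) {u..v}"
      using has_integral_const_real[of "c\<^sup>2" u v] uv unfolding J_def
      by (intro has_integral_add has_integral_diff has_integral_mult_right int sq integrable_integral) auto
    moreover have "(\<lambda>s. (deriv f s)\<^sup>2 - 2 * c * deriv f s + c\<^sup>2) = (\<lambda>s. (deriv f s - c)\<^sup>2)"
      by (simp add: power2_diff algebra_simps)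
    ultimately have *: "((\<lambda>s. (deriv f s - c)\<^sup>2) has_integral
        J u v - 2 * c * (f v - f u) + (v - u) * c\<^sup>2) {u..v}"
      by (simp only:)
    have "0 \<le> J u v - 2 * c * (f v - f u) + (v - u) * c\<^sup>2"
      by (rule has_integral_nonneg[OF *]) simp
    also have "\<dots> = J u v - (f v - f u)\<^sup>2 / (v - u)"
      using uv' by (simp add: c_def power2_eq_square)
    finally show ?thesis using uv' by (simp add: field_simps)
  qed (simp add: J_def)
  \<comment> \<open>For a non-integrable function the integral is 0 by convention, so all
    \<open>u\<close> and \<open>v\<close> are covered.\<close>
  have J_nonneg: "0 \<le> J u v" for u v
    unfolding J_def by (cases "(\<lambda>s. (deriv f s)\<^sup>2) integrable_on {u..v}")
      (auto intro!: Henstock_Kurzweil_Integration.integral_nonneg simp: not_integrable_integral)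
  have IJ: "I v - I u = J (max 1 u) (max 1 v)" if "u \<le> v" for u v
    using Henstock_Kurzweil_Integration.integral_combine[OF max.cobounded1[of 1 u]
        max.mono[OF order_refl that] sq[OF order_refl]] by (simp add: I_def J_def)
  have le: "max 1 v - max 1 u \<le> v - u" if "u \<le> v" for u v :: real using that by auto
  show thesis
  proof (rule that[of I "integral {1..} (\<lambda>s. (deriv f s)\<^sup>2)" F])
    show "0 \<le> I t" for t unfolding I_def by (rule J_nonneg)
    show "I t \<le> integral {1..} (\<lambda>s. (deriv f s)\<^sup>2)" for t
      unfolding I_def J_def by (rule integral_subset_le) (use sq sq1 in auto)
    show "0 \<le> F" using F[of 1] by simp
    fix u v :: real assume uv: "u \<le> v"
    have "f (max 1 v) - f (max 1 u) \<le> F * (max 1 v - max 1 u)"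
    proof (rule has_integral_le)
      show "(deriv f has_integral f (max 1 v) - f (max 1 u)) {max 1 u..max 1 v}" using uv by (intro int) auto
      show "((\<lambda>_. F) has_integral F * (max 1 v - max 1 u)) {max 1 u..max 1 v}"
        using has_integral_const_real[of F "max 1 u" "max 1 v"] max.mono[OF order_refl[of 1] uv]
        by (simp add: mult.commute)
      show "deriv f s \<le> F" if "s \<in> {max 1 u..max 1 v}" for s using F[of s] that by auto
    qed
    also have "\<dots> \<le> F * (v - u)" using le[OF uv] F[of 1] by (intro mult_left_mono) auto
    finally show "f (max 1 v) - f (max 1 u) \<le> F * (v - u)" .
    have "(f (max 1 v) - f (max 1 u))\<^sup>2 \<le> (max 1 v - max 1 u) * J (max 1 u) (max 1 v)"
      using uv by (intro CS) auto
    also have "\<dots> \<le> (v - u) * J (max 1 u) (max 1 v)"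
      using le[OF uv] J_nonneg by (intro mult_right_mono) auto
    finally show "(f (max 1 v) - f (max 1 u))\<^sup>2 \<le> (v - u) * (I v - I u)" by (simp only: IJ[OF uv])
  qed
qed

theorem theorem2:
  fixes M :: "'a measure" and X :: "real \<Rightarrow> 'a \<Rightarrow> real"
    and \<sigma>2 b \<delta> :: real and \<nu> :: "real measure" and f :: "real \<Rightarrow> real"
  assumes "levy_process M X"
    and "has_levy_triplet M X \<sigma>2 b \<nu>"
    and "emeasure \<nu> {0<..} > 0" and "emeasure \<nu> {..<0} > 0"
    and "\<And>s. 0 \<le> s \<Longrightarrow> 0 \<le> f s"
    and "f differentiable_on {0..}"
    and "mono_on {0..} f"
    and "set_integrable lborel {1..} (\<lambda>s. (deriv f s)\<^sup>2)"
    and "bdd_above ((\<lambda>s. \<bar>deriv f s\<bar>) ` {1..})"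
    and "\<delta> > 0"
    and "has_decay_exponent (prob_below M X (\<lambda>t. 1)) \<delta>"
  shows "has_decay_exponent (prob_below M X (\<lambda>t. 1 + f t)) \<delta>"
proof -
  interpret levy_process M X by fact
  have cont: "continuous_on {0..} f" by (rule differentiable_imp_continuous_on) fact
  have mono: "f u \<le> f v" if "0 \<le> u" "u \<le> v" for u v
    using \<open>mono_on {0..} f\<close> by (rule mono_onD) (use that in auto)
  obtain I C F where I: "\<And>t. 0 \<le> I t" "\<And>t. I t \<le> C"
    and g: "\<And>u v. u \<le> v \<Longrightarrow> f (max 1 v) - f (max 1 u) \<le> F * (v - u)"
      "\<And>u v. u \<le> v \<Longrightarrow> (f (max 1 v) - f (max 1 u))\<^sup>2 \<le> (v - u) * (I v - I u)"
    using square_integrable_derivative_bounds[OF assms(6,8,9)] by metis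
  have cont1: "continuous_on {0..} (\<lambda>_::real. 1::real)" by simp
  show ?thesis
  proof (rule has_decay_exponent_compare[OF assms(11)])
    fix T :: real assume T: "1 \<le> T"
    show "prob_below M X (\<lambda>t. 1) T \<le> prob_below M X (\<lambda>t. 1 + f t) T"
      using T assms(5) by (intro prob_below_mono continuous_on_add cont continuous_on_const) auto
  next
    fix p :: nat assume p: "2 \<le> p"
    \<comment> \<open>Decay gives positivity for large \<open>T\<close> only; monotonicity in the
      horizon carries it back to time 1.\<close>
    have pos: "0 < prob_below M X (\<lambda>_. 1) 1"
    proof -
      have "\<forall>\<^sub>F T in at_top. 0 < prob_below M X (\<lambda>t. 1) T \<and> 1 \<le> T"
        using assms(11) eventually_ge_at_top by (auto simp: has_decay_exponent_def intro: eventually_conj)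
      then obtain T where "0 < prob_below M X (\<lambda>t. 1) T" "1 \<le> T"
        by (auto dest: eventually_happens)
      then show ?thesis using prob_below_mono[OF cont1, of 1 T "\<lambda>_. 1"] by simp
    qed
    \<comment> \<open>As \<open>f\<close> is non-decreasing, \<open>f (max 1 t)\<close> majorises
      \<open>f\<close>, and its increments are controlled from time 0 on.\<close>
    obtain K where K: "K > 0" "\<And>n T. 0 < n \<Longrightarrow> real n \<le> T \<Longrightarrow> prob_below M X (\<lambda>t. 1 + f t) T
        \<le> K * prob_below M X (\<lambda>_. 1) (real (Suc n)) powr (1 - 1 / real p)"
      using prob_below_comparison[where g = "\<lambda>t. f (max 1 t)" and f = f, OF assms(2,4) pos p _ _ g I]
        assms(5) mono by fastforce
    have "prob_below M X (\<lambda>t. 1 + f t) T \<le> K * prob_below M X (\<lambda>t. 1) T powr (1 - 1 / real p)"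
      if T: "1 \<le> T" for T
    proof -
      \<comment> \<open>The comparison costs one extra unit of time: it leads from a horizon of at
        least \<open>n\<close> to \<open>n + 1\<close>, and \<open>n \<le> T \<le> n + 1\<close>
        allows \<open>T\<close> on both sides.\<close>
      define n where "n = nat \<lfloor>T\<rfloor>"
      have n: "0 < n" "real n \<le> T" "T \<le> real (Suc n)" using T by (auto simp: n_def) linarith+
      have "prob_below M X (\<lambda>_. 1) (real (Suc n)) \<le> prob_below M X (\<lambda>_. 1) T"
        using n T by (intro prob_below_mono[OF cont1]) auto
      then have "prob_below M X (\<lambda>_. 1) (real (Suc n)) powr (1 - 1 / real p) \<le> prob_below M X (\<lambda>_. 1) T powr (1 - 1 / real p)"
        using p by (intro powr_mono2) (auto simp: prob_below_def)
      then show ?thesis using K(2)[OF n(1,2)] K(1) by (meson mult_left_mono less_imp_le order_trans)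
    qed
    then show "\<exists>K>0. \<forall>T\<ge>1. prob_below M X (\<lambda>t. 1 + f t) T \<le> K * prob_below M X (\<lambda>t. 1) T powr (1 - 1 / real p)"
      using K(1) by blast
  qed
qed

end
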